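(* Let $U$ and $M$ be finite sets, and let $U_f\subseteq U$ for $f\in M$. A maximum subset $F\subseteq M$ such that $(U_f)_{f\in F}$ has a forest representative system can be computed in $O\bigl(|M|\sum_{f\in M}|U_f|\bigr)$ time.
   Context: For finite sets $U$, $F$ and subsets $U_f\subseteq U$ ($f\in F$), a forest representative system for $(U_f)_{f\in F}$ is a family $(e_f)_{f\in F}$ with $e_f\in\binom{U_f}{2}$ (a 2-element subset of $U_f$) for all $f\in F$, $e_f\neq e_{f'}$ for $f\neq f'$, such that the graph $(U,\{e_f: f\in F\})$ is a forest. *)

theory Defs
  imports Main
begin

section \<open>Forest representative systems\<close>

text \<open>
  Graphs are simple and undirected, with 2-element sets as edges. (The forests of the AFP entry
  on digraphs exclude directed cycles, so that a symmetric pair of arcs is already a cycle there.)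
\<close>

definition is_cycle :: "'a set set \<Rightarrow> 'a list \<Rightarrow> bool" where
  "is_cycle E p \<longleftrightarrow> 3 \<le> length p \<and> distinct p \<and>
     (\<forall>i<length p. {p ! i, p ! (Suc i mod length p)} \<in> E)"

definition forest :: "'a set \<Rightarrow> 'a set set \<Rightarrow> bool" where
  "forest V E \<longleftrightarrow> finite V \<and> (\<forall>e\<in>E. e \<subseteq> V \<and> card e = 2) \<and> (\<nexists>p. is_cycle E p)"

definition forest_rep_system ::
  "'a set \<Rightarrow> 'b set \<Rightarrow> ('b \<Rightarrow> 'a set) \<Rightarrow> ('b \<Rightarrow> 'a set) \<Rightarrow> bool" where
  "forest_rep_system U F Us e \<longleftrightarrow>
     (\<forall>f\<in>F. e f \<subseteq> Us f \<and> card (e f) = 2) \<and> inj_on e F \<and> forest U (e ` F)"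

definition has_frs :: "'a set \<Rightarrow> 'b set \<Rightarrow> ('b \<Rightarrow> 'a set) \<Rightarrow> bool" where
  "has_frs U F Us \<longleftrightarrow> (\<exists>e. forest_rep_system U F Us e)"

definition maximum_frs_subset :: "'a set \<Rightarrow> 'b set \<Rightarrow> ('b \<Rightarrow> 'a set) \<Rightarrow> 'b set \<Rightarrow> bool" where
  "maximum_frs_subset U M Us F \<longleftrightarrow> F \<subseteq> M \<and> has_frs U F Us \<and>
     (\<forall>F'. F' \<subseteq> M \<and> has_frs U F' Us \<longrightarrow> card F' \<le> card F)"

section \<open>A word RAM\<close>

text \<open>
  The machine is a random access machine with structured control flow. A program mentions
  finitely many registers and finitely many arrays of words. Every operation (constant, register
  access, array access, addition, truncated subtraction, comparison, store, loop or branch test)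
  costs one time unit. The parameter \<open>W\<close> is the largest number fitting into a word: an
  execution in which a larger number arises, even as an intermediate result or as an array
  index, is stuck. Hence unit costs cannot be abused by computing with very large numbers.
\<close>

record state =
  reg :: "string \<Rightarrow> nat"
  arr :: "string \<Rightarrow> nat \<Rightarrow> nat"

datatype exp =
    Num nat
  | Var string
  | Read string exp
  | Add exp exp
  | Sub exp exp

fun eval :: "state \<Rightarrow> exp \<Rightarrow> nat" where
  "eval s (Num k) = k"
| "eval s (Var x) = reg s x"
| "eval s (Read a e) = arr s a (eval s e)"
| "eval s (Add d e) = eval s d + eval s e"
| "eval s (Sub d e) = eval s d - eval s e"

fun fits :: "nat \<Rightarrow> state \<Rightarrow> exp \<Rightarrow> bool" where
  "fits W s (Num k) \<longleftrightarrow> k \<le> W"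
| "fits W s (Var x) \<longleftrightarrow> reg s x \<le> W"
| "fits W s (Read a e) \<longleftrightarrow> fits W s e \<and> arr s a (eval s e) \<le> W"
| "fits W s (Add d e) \<longleftrightarrow> fits W s d \<and> fits W s e \<and> eval s d + eval s e \<le> W"
| "fits W s (Sub d e) \<longleftrightarrow> fits W s d \<and> fits W s e"

fun exp_cost :: "exp \<Rightarrow> nat" where
  "exp_cost (Num k) = 1"
| "exp_cost (Var x) = 1"
| "exp_cost (Read a e) = exp_cost e + 1"
| "exp_cost (Add d e) = exp_cost d + exp_cost e + 1"
| "exp_cost (Sub d e) = exp_cost d + exp_cost e + 1"

datatype test = Less exp exp | Equal exp exp

fun test_eval :: "state \<Rightarrow> test \<Rightarrow> bool" where
  "test_eval s (Less d e) \<longleftrightarrow> eval s d < eval s e"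
| "test_eval s (Equal d e) \<longleftrightarrow> eval s d = eval s e"

fun test_fits :: "nat \<Rightarrow> state \<Rightarrow> test \<Rightarrow> bool" where
  "test_fits W s (Less d e) \<longleftrightarrow> fits W s d \<and> fits W s e"
| "test_fits W s (Equal d e) \<longleftrightarrow> fits W s d \<and> fits W s e"

fun test_cost :: "test \<Rightarrow> nat" where
  "test_cost (Less d e) = exp_cost d + exp_cost e + 1"
| "test_cost (Equal d e) = exp_cost d + exp_cost e + 1"

datatype com =
    Skip
  | Assign string exp
  | Store string exp exp
  | Seq com com
  | If test com com
  | While test com

text \<open>\<open>exec W c s t s'\<close>: with word bound \<open>W\<close>, program \<open>c\<close> started in \<open>s\<close> halts in \<open>s'\<close>
  after exactly \<open>t\<close> time units. \<open>Store a d e\<close> is the assignment \<open>a[d] := e\<close>.\<close>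

inductive exec :: "nat \<Rightarrow> com \<Rightarrow> state \<Rightarrow> nat \<Rightarrow> state \<Rightarrow> bool" for W :: nat where
  Skip: "exec W Skip s 1 s"
| Assign: "fits W s e \<Longrightarrow>
    exec W (Assign x e) s (exp_cost e + 1) (s\<lparr>reg := (reg s)(x := eval s e)\<rparr>)"
| Store: "fits W s d \<Longrightarrow> fits W s e \<Longrightarrow>
    exec W (Store a d e) s (exp_cost d + exp_cost e + 1)
      (s\<lparr>arr := (arr s)(a := (arr s a)(eval s d := eval s e))\<rparr>)"
| Seq: "exec W c1 s t1 s1 \<Longrightarrow> exec W c2 s1 t2 s2 \<Longrightarrow> exec W (Seq c1 c2) s (t1 + t2) s2"
| IfTrue: "test_fits W s b \<Longrightarrow> test_eval s b \<Longrightarrow> exec W c1 s t s1 \<Longrightarrow>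
    exec W (If b c1 c2) s (test_cost b + t) s1"
| IfFalse: "test_fits W s b \<Longrightarrow> \<not> test_eval s b \<Longrightarrow> exec W c2 s t s1 \<Longrightarrow>
    exec W (If b c1 c2) s (test_cost b + t) s1"
| WhileFalse: "test_fits W s b \<Longrightarrow> \<not> test_eval s b \<Longrightarrow>
    exec W (While b c) s (test_cost b) s"
| WhileTrue: "test_fits W s b \<Longrightarrow> test_eval s b \<Longrightarrow> exec W c s t1 s1 \<Longrightarrow>
    exec W (While b c) s1 t2 s2 \<Longrightarrow> exec W (While b c) s (test_cost b + t1 + t2) s2"

inductive_cases exec_SkipE: "exec W Skip s t s'"
inductive_cases exec_AssignE: "exec W (Assign x e) s t s'"
inductive_cases exec_StoreE: "exec W (Store a d e) s t s'"
inductive_cases exec_SeqE: "exec W (Seq c1 c2) s t s'"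
inductive_cases exec_IfE: "exec W (If b c1 c2) s t s'"
inductive_cases exec_WhileE: "exec W (While b c) s t s'"

lemma exec_deterministic:
  "exec W c s t s' \<Longrightarrow> exec W c s u s'' \<Longrightarrow> t = u \<and> s' = s''"
proof (induction arbitrary: u s'' rule: exec.induct)
  case (Skip s) then show ?case by (auto elim: exec_SkipE)
next
  case (Assign s e x) then show ?case by (auto elim: exec_AssignE)
next
  case (Store s d e a) then show ?case by (auto elim: exec_StoreE)
next
  case (Seq c1 s t1 s1 c2 t2 s2)
  from Seq.prems show ?case by (rule exec_SeqE) (use Seq.IH in blast)
next
  case (IfTrue s b c1 t s1 c2)
  from IfTrue.prems show ?case by (rule exec_IfE) (use IfTrue in blast)+
next
  case (IfFalse s b c2 t s1 c1)
  from IfFalse.prems show ?case by (rule exec_IfE) (use IfFalse in blast)+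
next
  case (WhileFalse s b c)
  from WhileFalse.prems show ?case by (rule exec_WhileE) (use WhileFalse in blast)+
next
  case (WhileTrue s b c t1 s1 t2 s2)
  from WhileTrue.prems show ?case by (rule exec_WhileE) (use WhileTrue in blast)+
qed

section \<open>Input and output\<close>

text \<open>
  \<open>us\<close> and \<open>ms\<close> number the elements of \<open>U\<close> and \<open>M\<close>; \<open>rows ! j\<close> lists, in any order and without
  repetition, the numbers of the elements of \<open>U\<^sub>f\<close> for the \<open>f\<close> with number \<open>j\<close>.
\<close>

definition listing ::
  "'a set \<Rightarrow> 'b set \<Rightarrow> ('b \<Rightarrow> 'a set) \<Rightarrow> 'a list \<Rightarrow> 'b list \<Rightarrow> nat list list \<Rightarrow> bool" where
  "listing U M Us us ms rows \<longleftrightarrow>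
     distinct us \<and> set us = U \<and> distinct ms \<and> set ms = M \<and> length rows = length ms \<and>
     (\<forall>j<length ms. distinct (rows ! j) \<and> (\<forall>i\<in>set (rows ! j). i < length us) \<and>
        (\<lambda>i. us ! i) ` set (rows ! j) = Us (ms ! j))"

text \<open>
  The rows are stored consecutively in the array \<open>elem\<close>; row \<open>j\<close> occupies the positions from
  \<open>off[j]\<close> up to, but excluding, \<open>off[j+1]\<close>. All unused memory is zero.
\<close>

definition input_state :: "nat \<Rightarrow> nat list list \<Rightarrow> state" where
  "input_state n rows = \<lparr>
     reg = (\<lambda>_. 0)(''n'' := n, ''m'' := length rows),
     arr = (\<lambda>_ _. 0)(
       ''off'' := (\<lambda>j. if j \<le> length rows then length (concat (take j rows)) else 0),
       ''elem'' := (\<lambda>k. if k < length (concat rows) then concat rows ! k else 0))\<rparr>"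

text \<open>The output is a list without repetitions of the numbers of the elements of \<open>F\<close>: its length
  is in register \<open>k\<close>, its entries are in array \<open>out\<close>.\<close>

definition output_represents :: "'b list \<Rightarrow> state \<Rightarrow> 'b set \<Rightarrow> bool" where
  "output_represents ms s F \<longleftrightarrow>
     inj_on (arr s ''out'') {..<reg s ''k''} \<and>
     (\<forall>i<reg s ''k''. arr s ''out'' i < length ms) \<and>
     F = (\<lambda>i. ms ! arr s ''out'' i) ` {..<reg s ''k''}"

end

(*
  By a theorem of Lovasz, a family has a forest representative system iff every nonempty
  subfamily of k sets has more than k elements in its union. If the greedy algorithm keeps F and
  rejects every other f because f together with some X in F violates this, then F is maximum:
  call a subfamily of k sets tight if its union has k + 1 elements. The maximal tight subfamilies of
  F are disjoint. Each member of an independent F' either is a member of F in no tight subfamily, or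
  lies inside the union of a maximal tight subfamily Y, and at most |Y| members can do the latter.

  To decide whether f can be added, the algorithm maintains a matching of the accepted sets into U.
  It searches for an alternating path from f to a free element, augments along it and searches from
  the now matched f again: both searches succeed iff f can be added, and a failing search exhibits a
  violating subfamily. If only the second one fails, unmatching f restores a matching of the
  accepted sets. A search scans each matched set at most once; since matched sets are nonempty, it
  takes time linear in the total size. The marks of a search are time stamps and need no clearing.
*)

theory Submission
  imports Defs
begin

section \<open>The theorem of Lovasz\<close>

text \<open>This is the condition of Lovasz: Hall's condition with a surplus of one.\<close>

definition hall :: "('b \<Rightarrow> 'a set) \<Rightarrow> 'b set \<Rightarrow> bool" where
  "hall H F \<longleftrightarrow> (\<forall>X\<subseteq>F. X \<noteq> {} \<longrightarrow> card X < card (\<Union>(H ` X)))"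

section \<open>Necessity of the condition: acyclic graphs have fewer edges than vertices\<close>

lemma hallD: "hall H F \<Longrightarrow> X \<subseteq> F \<Longrightarrow> X \<noteq> {} \<Longrightarrow> card X < card (\<Union>(H ` X))"
  by (simp add: hall_def)

text \<open>A longest path cannot be extended at its first vertex, so a second edge at this vertex
  leads back to the path and closes a cycle.\<close>

lemma cycle_if_no_leaf:
  assumes fin: "finite (\<Union>E)" and ne: "E \<noteq> {}" and two: "\<forall>e\<in>E. card e = 2"
    and deg: "\<And>v e. e \<in> E \<Longrightarrow> v \<in> e \<Longrightarrow> \<exists>e'\<in>E. v \<in> e' \<and> e' \<noteq> e"
  shows "\<exists>p. is_cycle E p"
proof -
  define path where "path p \<longleftrightarrow> distinct p \<and> set p \<subseteq> \<Union>E \<and> 2 \<le> length p \<and>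
    (\<forall>i. Suc i < length p \<longrightarrow> {p ! i, p ! Suc i} \<in> E)" for p
  obtain e where "e \<in> E" using ne by blast
  then obtain x y where xy: "e = {x, y}" "x \<noteq> y" using two by (meson card_2_iff)
  have "path [x, y]" using \<open>e \<in> E\<close> xy by (auto simp: path_def less_Suc_eq)
  moreover have bound: "length p \<le> card (\<Union>E)" if "path p" for p
    using that card_mono[OF fin, of "set p"] by (simp add: path_def distinct_card)
  ultimately obtain p where p: "path p" and max: "\<And>q. path q \<Longrightarrow> length q \<le> length p"
    using ex_has_greatest_nat[of path "[x, y]" length "Suc (card (\<Union>E))"] by (auto simp: less_Suc_eq_le)
  have e01: "{p ! 0, p ! Suc 0} \<in> E" using p by (auto simp: path_def)
  obtain e' where e': "e' \<in> E" "p ! 0 \<in> e'" "e' \<noteq> {p ! 0, p ! Suc 0}"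
    using deg[OF e01, of "p ! 0"] by auto
  have "card (e' - {p ! 0}) = 1" using two e'(1,2) by (simp add: card_Diff_singleton)
  then obtain w where "e' - {p ! 0} = {w}" by (rule card_1_singletonE)
  then have w: "e' = {p ! 0, w}" "w \<noteq> p ! 0" using e'(2) by blast+
  have "w \<in> set p"
  proof (rule ccontr)
    assume "w \<notin> set p"
    moreover have "{(w # p) ! i, (w # p) ! Suc i} \<in> E" if "Suc i < length (w # p)" for i
      using that p w e' by (cases i) (auto simp: path_def insert_commute)
    moreover have "w \<in> \<Union>E" using e' w by auto
    ultimately have "path (w # p)" using p by (auto simp: path_def)
    then show False using max by fastforce
  qed
  then obtain i where i: "i < length p" "p ! i = w" by (auto simp: in_set_conv_nth)
  \<comment> \<open>The vertex \<open>w\<close> differs from the first vertex, and from the second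
    one because \<open>e'\<close> is not the first edge; hence the cycle has at least three
    vertices.\<close>
  have "i \<noteq> 0" "i \<noteq> Suc 0" using i w e' by (metis, metis)
  then have i2: "2 \<le> i" by simp
  let ?c = "take (Suc i) p"
  have "is_cycle E ?c"
    unfolding is_cycle_def
  proof (intro conjI allI impI)
    show "3 \<le> length ?c" using i i2 by simp
    show "distinct ?c" using p by (simp add: path_def)
    fix a assume a: "a < length ?c"
    show "{?c ! a, ?c ! (Suc a mod length ?c)} \<in> E"
    proof (cases "a = i")
      case True
      then show ?thesis using i w e' by (simp add: min_absorb2 insert_commute Suc_leI)
    next
      case False
      then show ?thesis using a i p by (auto simp: path_def min_absorb2 Suc_leI)
    qed
  qed
  then show ?thesis by blast
qed

text \<open>Some vertex lies in only one edge, since otherwise there is a cycle. Removing this edge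
  loses one edge and at least one covered vertex, so induction applies.\<close>

lemma acyclic_card:
  assumes "finite E" "E \<noteq> {}" "\<forall>e\<in>E. card e = 2" "\<nexists>p. is_cycle E p"
  shows "card E < card (\<Union>E)"
  using assms
proof (induction "card E" arbitrary: E)
  case 0
  then show ?case by simp
next
  case (Suc k)
  have fin: "finite (\<Union>E)"
    using Suc.prems by (metis card.infinite finite_Union zero_neq_numeral)
  then obtain v e where ve: "e \<in> E" "v \<in> e" and leaf: "\<forall>e'\<in>E. v \<in> e' \<longrightarrow> e' = e"
    using cycle_if_no_leaf[of E] Suc.prems by meson
  show ?case
  proof (cases "E = {e}")
    case True
    then show ?thesis using Suc.prems by simp
  next
    case False
    let ?E = "E - {e}"
    have "card ?E = k" using Suc.hyps ve Suc.prems by simp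
    moreover have "\<nexists>p. is_cycle ?E p" using Suc.prems(4) by (auto simp: is_cycle_def)
    ultimately have "card ?E < card (\<Union>?E)" using Suc.hyps(1)[of ?E] False Suc.prems ve by blast
    moreover have "\<Union>?E \<subset> \<Union>E" using ve leaf by blast
    then have "card (\<Union>?E) < card (\<Union>E)" using fin by (rule psubset_card_mono[rotated])
    ultimately show ?thesis using \<open>card ?E = k\<close> Suc.hyps by linarith
  qed
qed

text \<open>By injectivity, \<open>X\<close> has as many representatives as members; these are the
  edges of an acyclic graph whose covered vertices lie in the union of the sets.\<close>

lemma frs_imp_hall:
  assumes "finite F" and fin: "\<And>f. f \<in> F \<Longrightarrow> finite (H f)" and e: "forest_rep_system U F H e"
  shows "hall H F"
  unfolding hall_def
proof (intro allI impI)
  fix X assume X: "X \<subseteq> F" "X \<noteq> {}"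
  have "card X = card (e ` X)"
    using e X by (metis card_image forest_rep_system_def inj_on_subset)
  also have "\<dots> < card (\<Union>(e ` X))"
  proof (rule acyclic_card)
    show "finite (e ` X)" using X assms finite_subset by blast
    show "\<nexists>p. is_cycle (e ` X) p"
      using e X unfolding forest_rep_system_def forest_def is_cycle_def by (meson image_mono subsetD)
  qed (use e X in \<open>auto simp: forest_rep_system_def\<close>)
  also have "\<dots> \<le> card (\<Union>(H ` X))"
  proof (rule card_mono)
    show "finite (\<Union>(H ` X))" using X assms by (meson finite_UN_I finite_subset subsetD)
    show "\<Union>(e ` X) \<subseteq> \<Union>(H ` X)" using e X unfolding forest_rep_system_def by fast
  qed
  finally show "card X < card (\<Union>(H ` X))" .
qed

section \<open>Sufficiency of the condition: shrinking all sets to pairs\<close>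

lemma cycle_edges_inj:
  assumes "is_cycle E p"
  shows "inj_on (\<lambda>i. {p ! i, p ! (Suc i mod length p)}) {..<length p}"
proof (rule inj_onI)
  let ?L = "length p"
  fix i j assume ij: "i \<in> {..<?L}" "j \<in> {..<?L}"
    and eq: "{p ! i, p ! (Suc i mod ?L)} = {p ! j, p ! (Suc j mod ?L)}"
  have L: "3 \<le> ?L" "distinct p" using assms by (auto simp: is_cycle_def)
  have lt: "Suc i mod ?L < ?L" "Suc j mod ?L < ?L" using L(1) by (intro mod_less_divisor; linarith)+
  show "i = j"
  proof (rule ccontr)
    assume "i \<noteq> j"
    then have "p ! i \<noteq> p ! j" using L ij by (simp add: nth_eq_iff_index_eq)
    then have "p ! i = p ! (Suc j mod ?L)" "p ! j = p ! (Suc i mod ?L)"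
      using eq by (metis doubleton_eq_iff)+
    \<comment> \<open>Each of the two positions is now the cyclic successor of the other, which is
      impossible in length at least three.\<close>
    then have "i = Suc j mod ?L" "j = Suc i mod ?L"
      using L ij lt by (simp_all add: nth_eq_iff_index_eq)
    moreover have "Suc a mod ?L = (if Suc a = ?L then 0 else Suc a)" if "a < ?L" for a
      using that by auto
    ultimately show False using L(1) ij by (auto split: if_splits)
  qed
qed

text \<open>Pairs leave no choice of representatives. Two equal pairs, or the pairs along a cycle,
  would be a subfamily whose union has no more elements than the subfamily has members.\<close>

lemma hall_imp_frs_pairs:
  assumes "finite U" and sub: "\<And>f. f \<in> F \<Longrightarrow> H f \<subseteq> U" and hall: "hall H F"
    and two: "\<And>f. f \<in> F \<Longrightarrow> card (H f) = 2"
  shows "forest_rep_system U F H H"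
proof -
  have inj: "inj_on H F"
  proof (rule inj_onI, rule ccontr)
    fix f g assume "f \<in> F" "g \<in> F" "H f = H g" "f \<noteq> g"
    then show False using hallD[OF hall, of "{f, g}"] two by auto
  qed
  have "\<not> is_cycle (H ` F) p" for p
  proof
    assume p: "is_cycle (H ` F) p"
    let ?ed = "\<lambda>i. {p ! i, p ! (Suc i mod length p)}"
    let ?X = "{f \<in> F. H f \<in> ?ed ` {..<length p}}"
    have L: "3 \<le> length p" "distinct p" using p by (auto simp: is_cycle_def)
    have "H ` {f \<in> F. H f \<in> B} = B" if "B \<subseteq> H ` F" for B using that by blast
    moreover have "?ed ` {..<length p} \<subseteq> H ` F" using p by (auto simp: is_cycle_def)
    ultimately have img: "H ` ?X = ?ed ` {..<length p}" by blast
    have "card ?X = card (H ` ?X)"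
      by (rule card_image[symmetric]) (use inj in \<open>auto intro: inj_on_subset\<close>)
    also have "\<dots> = length p" using img cycle_edges_inj[OF p] by (simp add: card_image)
    finally have cX: "card ?X = length p" .
    have lt: "Suc i mod length p < length p" for i using L by (intro mod_less_divisor) linarith
    then have "\<Union>(?ed ` {..<length p}) \<subseteq> set p" by (auto intro!: nth_mem)
    then have "card (\<Union>(H ` ?X)) \<le> length p"
      unfolding img using L by (metis List.finite_set card_mono distinct_card)
    moreover have "?X \<noteq> {}" using cX L by (metis card.empty not_numeral_le_zero)
    ultimately show False using hallD[OF hall, of ?X] cX by force
  qed
  then show ?thesis using assms inj by (auto simp: forest_rep_system_def forest_def)
qed

text \<open>Otherwise the removals of \<open>a\<close> and of \<open>b\<close> are blocked by
  subfamilies \<open>Y\<close> and \<open>Z\<close>, with unions A and B of at most |Y| + 1 and |Z|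
  + 1 elements. But the condition gives |Y \<union> Z| + 2 elements in A \<union> B and |Y \<inter>
  Z| + 1 in A \<inter> B, one too many in total.\<close>

lemma hall_shrink:
  assumes fin: "finite F" "\<And>f. f \<in> F \<Longrightarrow> finite (H f)" and hall: "hall H F"
    and f: "f \<in> F" and three: "3 \<le> card (H f)"
  obtains u where "u \<in> H f" "hall (H(f := H f - {u})) F"
proof -
  \<comment> \<open>A violation after the removal must involve \<open>f\<close>, whose set alone has
    changed; \<open>Y\<close> is the violating subfamily without \<open>f\<close>.\<close>
  have no: "\<exists>Y\<subseteq>F - {f}. card (\<Union>(H ` Y) \<union> (H f - {u})) \<le> card Y + 1"
    if u: "\<not> hall (H(f := H f - {u})) F" for u
  proof -
    obtain X where X: "X \<subseteq> F" "X \<noteq> {}" "card (\<Union>((H(f := H f - {u})) ` X)) \<le> card X"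
      using u by (auto simp: hall_def not_less)
    have "f \<in> X"
    proof (rule ccontr)
      assume "f \<notin> X"
      then have "(H(f := H f - {u})) ` X = H ` X" by auto
      then show False using X hallD[OF hall, of X] by simp
    qed
    then have "(\<Union>((H(f := H f - {u})) ` X)) = \<Union>(H ` (X - {f})) \<union> (H f - {u})" by auto
    moreover have "card X = card (X - {f}) + 1"
      using \<open>f \<in> X\<close> X fin by (metis One_nat_def Suc_eq_plus1 card_Suc_Diff1 finite_subset)
    ultimately show ?thesis using X by (metis Diff_mono order_refl)
  qed
  have "\<exists>u\<in>H f. hall (H(f := H f - {u})) F"
  proof (rule ccontr)
    assume neg: "\<not> ?thesis"
    have "H f \<noteq> {}" using three by auto
    then obtain a where a: "a \<in> H f" by blast
    have "card (H f - {a}) \<ge> 2" using a three fin f by simp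
    then have "H f - {a} \<noteq> {}" by (metis card.empty not_numeral_le_zero)
    then obtain b where b: "b \<in> H f" "b \<noteq> a" by blast
    have "card (H f - {a} - {b}) \<ge> 1" using a b three fin f by simp
    then have "H f - {a} - {b} \<noteq> {}" by (metis card.empty not_one_le_zero)
    then obtain c where c: "c \<in> H f" "c \<noteq> a" "c \<noteq> b" by blast
    obtain Y where Y: "Y \<subseteq> F - {f}" "card (\<Union>(H ` Y) \<union> (H f - {a})) \<le> card Y + 1"
      using no[of a] neg a by auto
    obtain Z where Z: "Z \<subseteq> F - {f}" "card (\<Union>(H ` Z) \<union> (H f - {b})) \<le> card Z + 1"
      using no[of b] neg b by auto
    let ?A = "\<Union>(H ` Y) \<union> (H f - {a})" and ?B = "\<Union>(H ` Z) \<union> (H f - {b})"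
    have finYZ: "finite Y" "finite Z" "f \<notin> Y" "f \<notin> Z"
      using Y(1) Z(1) finite_subset[OF _ finite_Diff[OF fin(1)]] by blast+
    have "\<forall>g\<in>Y \<union> Z. finite (H g)" using Y(1) Z(1) fin by blast
    then have finAB: "finite ?A" "finite ?B" using finYZ fin(2)[OF f] by auto
    have "\<Union>(H ` insert f (Y \<union> Z)) \<subseteq> ?A \<union> ?B" using b by auto
    then have "card (\<Union>(H ` insert f (Y \<union> Z))) \<le> card (?A \<union> ?B)"
      by (intro card_mono) (use finAB in auto)
    moreover have "card (insert f (Y \<union> Z)) < card (\<Union>(H ` insert f (Y \<union> Z)))"
      by (rule hallD[OF hall]) (use Y Z f in auto)
    ultimately have 1: "card (Y \<union> Z) + 2 \<le> card (?A \<union> ?B)" using finYZ by simp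
    have 2: "card (Y \<inter> Z) + 1 \<le> card (?A \<inter> ?B)"
    proof (cases "Y \<inter> Z = {}")
      case True
      \<comment> \<open>For an empty intersection \<open>hall\<close> says nothing; the third
        element \<open>c\<close>, which survives both removals, supplies the common element.\<close>
      have "card {c} \<le> card (?A \<inter> ?B)" by (rule card_mono) (use finAB c in auto)
      then show ?thesis using True by simp
    next
      case False
      have "card (Y \<inter> Z) < card (\<Union>(H ` (Y \<inter> Z)))"
        by (rule hallD[OF hall]) (use False Y in auto)
      also have "\<dots> \<le> card (?A \<inter> ?B)" by (rule card_mono) (use finAB in auto)
      finally show ?thesis by simp
    qed
    show False
      using 1 2 Y(2) Z(2) card_Un_Int[OF finAB] card_Un_Int[OF finYZ(1,2)] by linarith
  qed
  then show ?thesis using that by blast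
qed

text \<open>Induction on the total size: sets of size at least three lose one element at a time
  until all are pairs, and representatives for smaller sets also serve the larger ones.\<close>

lemma hall_imp_frs:
  assumes "finite U" "finite F" "\<And>f. f \<in> F \<Longrightarrow> H f \<subseteq> U" "hall H F"
  shows "has_frs U F H"
  using assms(3,4)
proof (induction "\<Sum>f\<in>F. card (H f)" arbitrary: H rule: less_induct)
  case less
  have fin: "finite (H f)" if "f \<in> F" for f using that less.prems assms finite_subset by blast
  have ge2: "2 \<le> card (H f)" if "f \<in> F" for f using hallD[OF less.prems(2), of "{f}"] that by simp
  show ?case
  proof (cases "\<forall>f\<in>F. card (H f) = 2")
    case True
    then show ?thesis
      using hall_imp_frs_pairs[OF assms(1) less.prems] by (auto simp: has_frs_def)
  next
    case False
    then obtain f where f: "f \<in> F" "3 \<le> card (H f)"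
      using ge2 by (metis One_nat_def Suc_1 le_antisym not_less_eq_eq numeral_3_eq_3)
    obtain u where u: "u \<in> H f" "hall (H(f := H f - {u})) F"
      using hall_shrink[OF assms(2) fin less.prems(2) f] by blast
    let ?H = "H(f := H f - {u})"
    have "(\<Sum>g\<in>F. card (?H g)) < (\<Sum>g\<in>F. card (H g))"
    proof (rule sum_strict_mono_ex1)
      show "\<forall>g\<in>F. card (?H g) \<le> card (H g)" using fin by (auto intro!: card_mono)
      show "\<exists>g\<in>F. card (?H g) < card (H g)"
        using f u fin by (intro bexI[of _ f]) (auto intro: card_Diff1_less)
    qed fact
    moreover have "?H g \<subseteq> U" if "g \<in> F" for g using that less.prems(1)[OF that] by auto
    ultimately have "has_frs U F ?H" using less.hyps u by blast
    then obtain e where e: "forest_rep_system U F ?H e" by (auto simp: has_frs_def)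
    have "?H g \<subseteq> H g" for g by auto
    then have "forest_rep_system U F H e" using e unfolding forest_rep_system_def by (meson subset_trans)
    then show ?thesis by (auto simp: has_frs_def)
  qed
qed

lemma has_frs_iff_hall:
  assumes "finite U" "finite F" "\<And>f. f \<in> F \<Longrightarrow> H f \<subseteq> U"
  shows "has_frs U F H \<longleftrightarrow> hall H F"
  using hall_imp_frs[OF assms] frs_imp_hall[OF assms(2)] assms
  by (meson finite_subset has_frs_def)

section \<open>Optimality of the greedy algorithm\<close>

text \<open>The hypothesis \<open>rej\<close> may refer to the final \<open>F\<close>, since a
  violating subfamily found earlier survives the growth of \<open>F\<close>. The rest is a count
  over the maximal tight subfamilies and the members of \<open>F\<close> outside them.\<close>

lemma hall_greedy_maximum:
  assumes finM: "finite M" and finH: "\<And>f. f \<in> M \<Longrightarrow> finite (H f)" and FM: "F \<subseteq> M" and hall: "hall H F"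
    and rej: "\<And>f. f \<in> M - F \<Longrightarrow> \<exists>X\<subseteq>F. card (\<Union>(H ` insert f X)) \<le> card (insert f X)"
    and F': "F' \<subseteq> M" "hall H F'"
  shows "card F' \<le> card F"
proof -
  have finF: "finite F" using finM FM finite_subset by blast
  have finN: "finite (\<Union>(H ` X))" if "X \<subseteq> M" for X using that finM finH by (meson finite_UN_I finite_subset subsetD)
  define tight where "tight Y \<longleftrightarrow> Y \<subseteq> F \<and> Y \<noteq> {} \<and> card (\<Union>(H ` Y)) = card Y + 1" for Y
  \<comment> \<open>Submodularity again: the common members force at least |Y \<inter> Z| + 1 common
    elements, which leaves at most |Y \<union> Z| + 1 for the union, and \<open>hall\<close> gives
    the converse.\<close>
  have tight_Un: "tight (Y \<union> Z)" if "tight Y" "tight Z" "Y \<inter> Z \<noteq> {}" for Y Z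
  proof -
    let ?A = "\<Union>(H ` Y)" and ?B = "\<Union>(H ` Z)"
    have sub: "Y \<subseteq> F" "Z \<subseteq> F" using that by (auto simp: tight_def)
    have fin: "finite ?A" "finite ?B" "finite Y" "finite Z"
      using finN[of Y] finN[of Z] sub FM finite_subset[OF _ finF] by blast+
    have "card (Y \<inter> Z) < card (\<Union>(H ` (Y \<inter> Z)))"
      by (rule hallD[OF hall]) (use sub that in auto)
    also have "\<dots> \<le> card (?A \<inter> ?B)" by (rule card_mono) (use fin in auto)
    finally have "card (Y \<inter> Z) < card (?A \<inter> ?B)" .
    moreover have "card (Y \<union> Z) < card (\<Union>(H ` (Y \<union> Z)))"
      by (rule hallD[OF hall]) (use sub that in auto)
    moreover have "\<Union>(H ` (Y \<union> Z)) = ?A \<union> ?B" by auto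
    ultimately have "card (\<Union>(H ` (Y \<union> Z))) = card (Y \<union> Z) + 1"
      using card_Un_Int[OF fin(1,2)] card_Un_Int[OF fin(3,4)] that unfolding tight_def by simp
    then show ?thesis using sub that by (auto simp: tight_def)
  qed
  define T where "T = {Y. tight Y \<and> (\<forall>Z. tight Z \<longrightarrow> Y \<subseteq> Z \<longrightarrow> Z = Y)}"
  have T_sub: "T \<subseteq> Pow F" by (auto simp: T_def tight_def)
  then have finT: "finite T" using finF finite_subset by blast
  have disj: "Y \<inter> Z = {}" if "Y \<in> T" "Z \<in> T" "Y \<noteq> Z" for Y Z
  proof (rule ccontr)
    assume "Y \<inter> Z \<noteq> {}"
    then have "tight (Y \<union> Z)" using that tight_Un by (simp add: T_def)
    then have "Y \<union> Z = Y" "Y \<union> Z = Z" using that unfolding T_def by (blast, blast)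
    then show False using that by simp
  qed
  have max: "\<exists>Z\<in>T. Y \<subseteq> Z" if tY: "tight Y" for Y
  proof -
    have "{Z. tight Z} \<subseteq> Pow F" by (auto simp: tight_def)
    then have "finite {Z. tight Z}" using finF by (simp add: finite_subset)
    then obtain Z where "tight Z" "Y \<subseteq> Z" "\<forall>Z'. tight Z' \<longrightarrow> Z \<subseteq> Z' \<longrightarrow> Z = Z'"
      using finite_has_maximal2[of "{Z. tight Z}" Y] tY by auto
    then have "Z \<in> T" by (auto simp: T_def)
    then show ?thesis using \<open>Y \<subseteq> Z\<close> by blast
  qed
  have cover: "f \<in> F - \<Union>T \<or> (\<exists>Y\<in>T. H f \<subseteq> \<Union>(H ` Y))" if f: "f \<in> F'" for f
  proof (cases "f \<in> F")
    case True
    then show ?thesis by auto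
  next
    case False
    then obtain X where X: "X \<subseteq> F" "card (\<Union>(H ` insert f X)) \<le> card (insert f X)" using rej[of f] f F' by blast
    have fX: "f \<notin> X" "finite X" using X False finite_subset[OF _ finF] by blast+
    have fin: "finite (\<Union>(H ` insert f X))" by (rule finN) (use X FM F' f in auto)
    have "X \<noteq> {}"
    proof
      assume "X = {}"
      then show False using X hallD[OF F'(2), of "{f}"] f by simp
    qed
    \<comment> \<open>The union over \<open>X\<close> already has |X| + 1 elements, and there are no
      more after adding \<open>f\<close>; so \<open>X\<close> is tight and \<open>H f\<close>
      contributes nothing new.\<close>
    then have "card X < card (\<Union>(H ` X))" using hallD[OF hall] X by blast
    moreover have "card (\<Union>(H ` X)) \<le> card (\<Union>(H ` insert f X))" using fin by (intro card_mono) auto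
    ultimately have eq: "card (\<Union>(H ` X)) = card X + 1" "card (\<Union>(H ` insert f X)) = card X + 1"
      using X fX by auto
    have "\<Union>(H ` X) = \<Union>(H ` insert f X)" using fin eq by (intro card_subset_eq) auto
    moreover have "H f \<subseteq> \<Union>(H ` insert f X)" by simp
    ultimately have "H f \<subseteq> \<Union>(H ` X)" by (simp only:)
    moreover have "tight X" using eq X \<open>X \<noteq> {}\<close> by (simp add: tight_def)
    ultimately show ?thesis using max by (meson SUP_subset_mono order_refl subset_trans)
  qed
  let ?P = "\<lambda>Y. {f \<in> F'. H f \<subseteq> \<Union>(H ` Y)}"
  have finF': "finite F'" using F' finM finite_subset by blast
  have part: "card (?P Y) \<le> card Y" if Y: "Y \<in> T" for Y
  proof (cases "?P Y = {}")
    case True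
    then show ?thesis by (metis card.empty le0)
  next
    case False
    have "card (?P Y) < card (\<Union>(H ` ?P Y))" by (rule hallD[OF F'(2)]) (use False in auto)
    also have "\<dots> \<le> card (\<Union>(H ` Y))" by (rule card_mono) (use finN[of Y] Y T_sub FM in auto)
    finally show ?thesis using Y by (simp add: T_def tight_def)
  qed
  have "F' \<subseteq> (F - \<Union>T) \<union> (\<Union>Y\<in>T. ?P Y)" using cover by blast
  then have "card F' \<le> card ((F - \<Union>T) \<union> (\<Union>Y\<in>T. ?P Y))"
    using finF finT finF' by (intro card_mono) auto
  also have "\<dots> \<le> card (F - \<Union>T) + card (\<Union>Y\<in>T. ?P Y)" by (rule card_Un_le)
  also have "card (\<Union>Y\<in>T. ?P Y) \<le> (\<Sum>Y\<in>T. card (?P Y))" by (rule card_UN_le[OF finT])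
  also have "\<dots> \<le> (\<Sum>Y\<in>T. card Y)" by (rule sum_mono[OF part])
  also have "\<dots> = card (\<Union>T)"
    by (rule card_Union_disjoint[symmetric])
      (use disj T_sub finite_subset[OF _ finF] in \<open>auto simp: pairwise_def disjnt_def\<close>)
  also have "card (F - \<Union>T) + card (\<Union>T) = card F"
    using T_sub finF by (metis Sup_le_iff PowD add.commute card_Diff_subset card_mono finite_subset le_add_diff_inverse subsetD)
  finally show ?thesis by simp
qed

section \<open>Reasoning about running times\<close>

text \<open>\<open>a\<close> is the time spent before \<open>c\<close> starts, and the postcondition \<open>Q\<close> sees the total time: with
  an accumulated cost instead of a remaining budget, no truncated subtraction arises.\<close>

definition runs :: "nat \<Rightarrow> com \<Rightarrow> state \<Rightarrow> nat \<Rightarrow> (state \<Rightarrow> nat \<Rightarrow> bool) \<Rightarrow> bool" where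
  "runs W c s a Q \<longleftrightarrow> (\<exists>t s'. exec W c s t s' \<and> Q s' (a + t))"

lemma runs_Skip [simp]: "runs W Skip s a Q \<longleftrightarrow> Q s (a + 1)"
  by (auto simp: runs_def intro!: exI exec.Skip elim!: exec_SkipE)

lemma runs_Assign [simp]: "runs W (Assign x e) s a Q \<longleftrightarrow>
    fits W s e \<and> Q (s\<lparr>reg := (reg s)(x := eval s e)\<rparr>) (a + (exp_cost e + 1))"
  by (auto simp: runs_def intro!: exI exec.Assign elim!: exec_AssignE)

lemma runs_Store [simp]: "runs W (Store b d e) s a Q \<longleftrightarrow>
    fits W s d \<and> fits W s e \<and>
    Q (s\<lparr>arr := (arr s)(b := (arr s b)(eval s d := eval s e))\<rparr>) (a + (exp_cost d + exp_cost e + 1))"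
  by (auto simp: runs_def intro!: exI exec.Store elim!: exec_StoreE)

lemma runs_Seq [simp]:
  "runs W (Seq c1 c2) s a Q \<longleftrightarrow> runs W c1 s a (\<lambda>s' a'. runs W c2 s' a' Q)"
proof
  assume "runs W (Seq c1 c2) s a Q"
  then show "runs W c1 s a (\<lambda>s' a'. runs W c2 s' a' Q)"
    by (auto simp: runs_def add.assoc elim!: exec_SeqE)
next
  assume "runs W c1 s a (\<lambda>s' a'. runs W c2 s' a' Q)"
  then show "runs W (Seq c1 c2) s a Q"
    by (auto simp: runs_def add.assoc intro: exec.Seq)
qed

lemma runs_If [simp]: "runs W (If b c1 c2) s a Q \<longleftrightarrow>
    test_fits W s b \<and> runs W (if test_eval s b then c1 else c2) s (a + test_cost b) Q"
proof
  assume "runs W (If b c1 c2) s a Q"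
  then obtain t s' where "exec W (If b c1 c2) s t s'" "Q s' (a + t)" by (auto simp: runs_def)
  then show "test_fits W s b \<and> runs W (if test_eval s b then c1 else c2) s (a + test_cost b) Q"
    by (elim exec_IfE) (auto simp: runs_def add.assoc)
next
  assume *: "test_fits W s b \<and> runs W (if test_eval s b then c1 else c2) s (a + test_cost b) Q"
  then obtain t s' where t: "exec W (if test_eval s b then c1 else c2) s t s'" "Q s' (a + (test_cost b + t))"
    by (auto simp: runs_def add.assoc)
  have "exec W (If b c1 c2) s (test_cost b + t) s'"
    using * t(1) by (cases "test_eval s b") (auto intro: exec.IfTrue exec.IfFalse)
  then show "runs W (If b c1 c2) s a Q" using t(2) unfolding runs_def by blast
qed

lemma runs_mono: "runs W c s a Q \<Longrightarrow> (\<And>s' a'. Q s' a' \<Longrightarrow> R s' a') \<Longrightarrow> runs W c s a R"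
  unfolding runs_def by blast

text \<open>Every iteration takes time, so the time bound \<open>B\<close> itself proves termination.\<close>

lemma runs_While:
  assumes "I s a"
    and step: "\<And>s a. I s a \<Longrightarrow> a \<le> B \<and> test_fits W s b \<and>
      (if test_eval s b then runs W c s (a + test_cost b) I else Q s (a + test_cost b))"
  shows "runs W (While b c) s a Q"
  using assms(1)
proof (induction "B - a" arbitrary: s a rule: less_induct)
  case less
  note st = step[OF less.prems]
  show ?case
  proof (cases "test_eval s b")
    case False
    then show ?thesis using st by (auto simp: runs_def intro!: exec.WhileFalse exI)
  next
    case True
    then obtain t1 s1 where 1: "exec W c s t1 s1" "I s1 (a + test_cost b + t1)"
      using st by (auto simp: runs_def)
    have "0 < test_cost b" by (cases b) auto
    then have "B - (a + test_cost b + t1) < B - a" using conjunct1[OF step[OF 1(2)]] by linarith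
    from less.hyps[OF this 1(2)] obtain t2 s2 where 2: "exec W (While b c) s1 t2 s2"
      "Q s2 (a + test_cost b + t1 + t2)"
      by (auto simp: runs_def)
    have "exec W (While b c) s (test_cost b + t1 + t2) s2"
      using st True 1 2 by (intro exec.WhileTrue) auto
    then show ?thesis unfolding runs_def using 2(2)
      by (intro exI[of _ "test_cost b + t1 + t2"] exI[of _ s2]) (simp add: add.assoc)
  qed
qed

section \<open>The algorithm\<close>

abbreviation seq (infixr \<open>;;\<close> 60) where "c1 ;; c2 \<equiv> Seq c1 c2"

text \<open>Row \<open>g\<close> is matched to the element \<open>mrow[g]\<close>, and \<open>mate[u] - 1\<close> is the row of a matched element
  \<open>u\<close>, while \<open>mate[u] = 0\<close> marks a free one. The search with time stamp \<open>c\<close> visits rows in the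
  order of the queue \<open>q\<close>; \<open>vis[g] = c\<close> marks the visited rows and \<open>par[g]\<close> is the row from which
  \<open>g\<close> was reached. It sets the flag \<open>x\<close> when it meets a free element \<open>v\<close>, in row \<open>p\<close>.\<close>

definition scan :: com where
  "scan = While (Less (Var ''i'') (Var ''e''))
     (Assign ''u'' (Read ''elem'' (Var ''i'')) ;;
      Assign ''i'' (Add (Var ''i'') (Num 1)) ;;
      If (Equal (Read ''mate'' (Var ''u'')) (Num 0))
        (Assign ''x'' (Num 1) ;; Assign ''v'' (Var ''u'') ;; Assign ''p'' (Var ''g''))
        (Assign ''w'' (Sub (Read ''mate'' (Var ''u'')) (Num 1)) ;;
         If (Equal (Read ''vis'' (Var ''w'')) (Var ''c''))
           Skip
           (Store ''vis'' (Var ''w'') (Var ''c'') ;;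
            Store ''par'' (Var ''w'') (Var ''g'') ;;
            Store ''q'' (Var ''t'') (Var ''w'') ;;
            Assign ''t'' (Add (Var ''t'') (Num 1)))))"

definition search_loop :: com where
  "search_loop =
     While (Less (Var ''h'') (Var ''t''))
       (Assign ''g'' (Read ''q'' (Var ''h'')) ;;
        Assign ''h'' (Add (Var ''h'') (Num 1)) ;;
        Assign ''i'' (Read ''off'' (Var ''g'')) ;;
        Assign ''e'' (Read ''off'' (Add (Var ''g'') (Num 1))) ;;
        scan)"

definition search :: com where
  "search =
     Assign ''c'' (Add (Var ''c'') (Num 1)) ;;
     Store ''vis'' (Var ''j'') (Var ''c'') ;;
     Store ''q'' (Num 0) (Var ''j'') ;;
     Assign ''h'' (Num 0) ;;
     Assign ''t'' (Num 1) ;;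
     Assign ''x'' (Num 0) ;;
     search_loop"

text \<open>A loop condition cannot be negated, so \<open>p\<close> is compared with
  \<open>j\<close> by the sum of both truncated differences. Each round gives \<open>v\<close> to
  row \<open>p\<close>, takes the former element of \<open>p\<close> as the new \<open>v\<close>,
  and moves on to the parent row.\<close>

definition augment_loop :: com where
  "augment_loop =
     While (Less (Num 0) (Add (Sub (Var ''p'') (Var ''j'')) (Sub (Var ''j'') (Var ''p''))))
       (Assign ''w'' (Read ''mrow'' (Var ''p'')) ;;
        Store ''mate'' (Var ''v'') (Add (Var ''p'') (Num 1)) ;;
        Store ''mrow'' (Var ''p'') (Var ''v'') ;;
        Assign ''v'' (Var ''w'') ;;
        Assign ''p'' (Read ''par'' (Var ''p'')))"

definition augment :: com where
  "augment =
     augment_loop ;;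
     Store ''mate'' (Var ''v'') (Add (Var ''j'') (Num 1)) ;;
     Store ''mrow'' (Var ''j'') (Var ''v'')"

text \<open>Runs after the second search, whose failure frees the element of \<open>j\<close> again.
  The entry \<open>mrow[j]\<close> may stay, as only matched rows are constrained.\<close>

definition decide :: com where
  "decide =
     If (Equal (Var ''x'') (Num 0))
       (Store ''mate'' (Read ''mrow'' (Var ''j'')) (Num 0))
       (Store ''out'' (Var ''k'') (Var ''j'') ;;
        Assign ''k'' (Add (Var ''k'') (Num 1)))"

definition process_row :: com where
  "process_row =
     search ;;
     If (Equal (Var ''x'') (Num 0)) Skip (augment ;; search ;; decide) ;;
     Assign ''j'' (Add (Var ''j'') (Num 1))"

text \<open>The guard catches the total size zero, where a loop over \<open>m\<close> rows would
  exceed the constant time then allowed. The initial memory already encodes the empty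
  output.\<close>

definition greedy :: com where
  "greedy =
     If (Equal (Read ''off'' (Var ''m'')) (Num 0)) Skip
       (While (Less (Var ''j'') (Var ''m'')) process_row)"

text \<open>The word bound has to cover array indices, offsets and the time stamps, which reach at
  most twice the number of rows; the factor 4 leaves slack.\<close>

locale rows_input =
  fixes rows :: "nat list list" and n W :: nat
  assumes bounded: "r \<in> set rows \<Longrightarrow> u \<in> set r \<Longrightarrow> u < n"
    and W: "4 * (n + length rows + length (concat rows) + 1) \<le> W"
begin

section \<open>Layout of the rows in memory\<close>

abbreviation m where "m \<equiv> length rows"
abbreviation S where "S \<equiv> length (concat rows)"
definition H where "H g = set (rows ! g)"
definition off where "off j = length (concat (take j rows))"

lemma H_bound: "g < m \<Longrightarrow> u \<in> H g \<Longrightarrow> u < n"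
  using bounded[of "rows ! g" u] by (simp add: H_def)

lemma off_Suc: "g < m \<Longrightarrow> off (Suc g) = off g + length (rows ! g)"
  by (simp add: off_def take_Suc_conv_app_nth)

lemma off_le: "off g \<le> S"
proof -
  have "concat rows = concat (take g rows) @ concat (drop g rows)"
    by (metis append_take_drop_id concat_append)
  then show ?thesis by (simp add: off_def)
qed

lemma nth_concat_off:
  assumes "g < m" "k < length (rows ! g)"
  shows "concat rows ! (off g + k) = rows ! g ! k"
proof -
  have "rows = take g rows @ rows ! g # drop (Suc g) rows" using assms by (simp add: id_take_nth_drop)
  then have "concat rows = concat (take g rows) @ rows ! g @ concat (drop (Suc g) rows)"
    by (metis concat.simps(2) concat_append)
  then show ?thesis using assms by (simp add: off_def nth_append)
qed

lemma H_eq: "g < m \<Longrightarrow> H g = (!) (concat rows) ` {off g..<off (Suc g)}"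
proof -
  assume g: "g < m"
  have "{off g..<off (Suc g)} = (+) (off g) ` {0..<length (rows ! g)}"
    by (simp add: off_Suc g add.commute)
  then have "(!) (concat rows) ` {off g..<off (Suc g)} = (\<lambda>k. concat rows ! (off g + k)) ` {0..<length (rows ! g)}"
    by (simp only: image_image)
  also have "\<dots> = (!) (rows ! g) ` {0..<length (rows ! g)}"
    using g by (intro image_cong) (auto simp: nth_concat_off)
  also have "\<dots> = H g" by (simp add: H_def list.set_map[symmetric] map_nth flip: set_upt)
  finally show ?thesis by simp
qed

lemma sum_length: "J \<subseteq> {..<m} \<Longrightarrow> (\<Sum>g\<in>J. length (rows ! g)) \<le> S"
proof -
  assume "J \<subseteq> {..<m}"
  then have "(\<Sum>g\<in>J. length (rows ! g)) \<le> (\<Sum>g<m. length (rows ! g))" by (intro sum_mono2) auto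
  also have "\<dots> = S" by (simp add: length_concat sum_list_sum_nth atLeast0LessThan)
  finally show ?thesis .
qed

subsection \<open>Alternating search\<close>

text \<open>Values of \<open>mrow\<close> outside \<open>J\<close> are arbitrary, whereas
  \<open>mate\<close> is exact everywhere because the search reads it at any element that it
  meets.\<close>

definition matching :: "nat set \<Rightarrow> (nat \<Rightarrow> nat) \<Rightarrow> (nat \<Rightarrow> nat) \<Rightarrow> bool" where
  "matching J mate mrow \<longleftrightarrow> J \<subseteq> {..<m} \<and>
     (\<forall>g\<in>J. mrow g \<in> H g \<and> mate (mrow g) = Suc g) \<and>
     (\<forall>u. mate u \<noteq> 0 \<longrightarrow> mate u - 1 \<in> J \<and> mrow (mate u - 1) = u)"

lemma matching_mate_le: "matching J mate mrow \<Longrightarrow> mate u \<le> m"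
proof -
  assume "matching J mate mrow"
  then have "mate u \<noteq> 0 \<longrightarrow> mate u - 1 < m" unfolding matching_def by blast
  then show "mate u \<le> m" by linarith
qed

text \<open>A matched row is nonempty, so a constant time per matched row is also covered by the
  total size \<open>S\<close>.\<close>

lemma matching_card:
  assumes "matching J mate mrow"
  shows "card J \<le> S"
proof -
  have J: "J \<subseteq> {..<m}" using assms by (simp add: matching_def)
  have "1 \<le> length (rows ! g)" if "g \<in> J" for g
    using assms that by (force simp: matching_def H_def Suc_le_eq)
  then have "(\<Sum>g\<in>J. 1) \<le> (\<Sum>g\<in>J. length (rows ! g))" by (intro sum_mono)
  then show ?thesis using sum_length[OF J] by simp
qed

text \<open>\<open>P\<close> is the set of elements scanned so far.\<close>

definition bfs_inv where
  "bfs_inv K mate mrow j c q t vis par x v p P \<longleftrightarrow>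
     0 < t \<and> q 0 = j \<and> inj_on q {..<t} \<and> q ` {..<t} \<subseteq> K \<and>
     (\<forall>g. vis g = c \<longleftrightarrow> g \<in> q ` {..<t}) \<and> (\<forall>g. vis g \<le> c) \<and> x \<le> 1 \<and>
     (\<forall>b<t. 0 < b \<longrightarrow> (\<exists>b'<b. par (q b) = q b' \<and> mrow (q b) \<in> H (q b'))) \<and>
     (\<forall>u\<in>P. mate u \<noteq> 0 \<longrightarrow> mate u - 1 \<in> q ` {..<t}) \<and>
     (x = 0 \<longrightarrow> (\<forall>u\<in>P. mate u \<noteq> 0)) \<and>
     (x \<noteq> 0 \<longrightarrow> mate v = 0 \<and> v \<in> H p \<and> p \<in> q ` {..<t})"
  for c t x :: nat

lemma bfs_inv_start:
  assumes "j \<in> K" "\<And>g. vis g < c"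
  shows "bfs_inv K mate mrow j c (q(0 := j)) (Suc 0) (vis(j := c)) par 0 v p {}"
  using assms by (auto simp: bfs_inv_def inj_on_def less_imp_le less_imp_neq)

lemma bfs_inv_free:
  assumes "bfs_inv K mate mrow j c q t vis par x v p P" "mate u = 0" "u \<in> H g" "g \<in> q ` {..<t}"
  shows "bfs_inv K mate mrow j c q t vis par (Suc 0) u g (insert u P)"
  using assms unfolding bfs_inv_def by simp

lemma bfs_inv_old:
  assumes "bfs_inv K mate mrow j c q t vis par x v p P" "mate u \<noteq> 0" "vis (mate u - Suc 0) = c"
  shows "bfs_inv K mate mrow j c q t vis par x v p (insert u P)"
  using assms unfolding bfs_inv_def by simp

text \<open>An unmarked \<open>w\<close> is not yet in the queue, so \<open>q\<close> stays
  injective. Its parent \<open>g\<close> stands at an earlier position, which keeps chains of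
  parents well-founded.\<close>

lemma bfs_inv_new:
  assumes bfs: "bfs_inv K mate mrow j c q t vis par x v p P"
    and u: "mate u \<noteq> 0" "w = mate u - Suc 0" "vis w \<noteq> c" "w \<in> K" "mrow w = u" "u \<in> H g" "g \<in> q ` {..<t}"
  shows "bfs_inv K mate mrow j c (q(t := w)) (Suc t) (vis(w := c)) (par(w := g)) x v p (insert u P)"
proof -
  have b: "0 < t" "q 0 = j" "inj_on q {..<t}" "q ` {..<t} \<subseteq> K"
    and x: "x \<le> 1" and vis: "\<forall>g. vis g = c \<longleftrightarrow> g \<in> q ` {..<t}" "\<forall>g. vis g \<le> c"
    and par: "\<forall>b<t. 0 < b \<longrightarrow> (\<exists>b'<b. par (q b) = q b' \<and> mrow (q b) \<in> H (q b'))"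
    and P: "\<forall>u\<in>P. mate u \<noteq> 0 \<longrightarrow> mate u - 1 \<in> q ` {..<t}" "x = 0 \<longrightarrow> (\<forall>u\<in>P. mate u \<noteq> 0)"
      "x \<noteq> 0 \<longrightarrow> mate v = 0 \<and> v \<in> H p \<and> p \<in> q ` {..<t}"
    using bfs unfolding bfs_inv_def by - (elim conjE, assumption)+
  have w: "w \<notin> q ` {..<t}" using vis(1) u(3) by blast
  have im: "(q(t := w)) ` {..<Suc t} = insert w (q ` {..<t})"
    by (auto simp: lessThan_Suc image_iff)
  have inj: "inj_on (q(t := w)) {..<Suc t}"
    using b(3) w by (auto simp: lessThan_Suc inj_on_def)
  have path: "\<forall>b<Suc t. 0 < b \<longrightarrow> (\<exists>b'<b. (par(w := g)) ((q(t := w)) b) = (q(t := w)) b' \<and>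
      mrow ((q(t := w)) b) \<in> H ((q(t := w)) b'))"
  proof (intro allI impI)
    fix b assume b: "b < Suc t" "0 < b"
    show "\<exists>b'<b. (par(w := g)) ((q(t := w)) b) = (q(t := w)) b' \<and> mrow ((q(t := w)) b) \<in> H ((q(t := w)) b')"
    proof (cases "b = t")
      case True
      then show ?thesis using u(5-7) by auto
    next
      case False
      then have "b < t" using b by simp
      then obtain b' where b': "b' < b" "par (q b) = q b'" "mrow (q b) \<in> H (q b')"
        using par b(2) by blast
      moreover have "q b \<noteq> w" using w \<open>b < t\<close> by blast
      ultimately show ?thesis using \<open>b < t\<close> by (intro exI[of _ b']) simp
    qed
  qed
  show ?thesis
    unfolding bfs_inv_def im
  proof (intro conjI)
    show "\<forall>a. ((vis(w := c)) a = c) = (a \<in> insert w (q ` {..<t}))" "\<forall>a. (vis(w := c)) a \<le> c"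
      using vis by simp_all
    show "\<forall>a\<in>insert u P. mate a \<noteq> 0 \<longrightarrow> mate a - 1 \<in> insert w (q ` {..<t})"
      "x = 0 \<longrightarrow> (\<forall>a\<in>insert u P. mate a \<noteq> 0)"
      "x \<noteq> 0 \<longrightarrow> mate v = 0 \<and> v \<in> H p \<and> p \<in> insert w (q ` {..<t})"
      using P u(1,2) by simp_all
  qed (use b x inj path u(4) in simp_all)
qed

section \<open>Correctness and running time of the search program\<close>

lemma bfs_inv_card:
  assumes "bfs_inv K mate mrow j c q t vis par x v p P" "finite K"
  shows "t \<le> card K"
proof -
  have "inj_on q {..<t}" "q ` {..<t} \<subseteq> K" using assms(1) unfolding bfs_inv_def by blast+
  then show ?thesis using card_inj_on_le[of q "{..<t}" K] assms(2) by simp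
qed

definition frame ::
  "nat \<Rightarrow> nat \<Rightarrow> nat \<Rightarrow> (nat \<Rightarrow> nat) \<Rightarrow> (nat \<Rightarrow> nat) \<Rightarrow> (nat \<Rightarrow> nat) \<Rightarrow> state \<Rightarrow> bool" where
  "frame j c k mate mrow out s \<longleftrightarrow>
     reg s ''m'' = m \<and> (\<forall>i\<le>m. arr s ''off'' i = off i) \<and> (\<forall>i<S. arr s ''elem'' i = concat rows ! i) \<and>
     reg s ''j'' = j \<and> reg s ''c'' = c \<and> reg s ''k'' = k \<and>
     arr s ''mate'' = mate \<and> arr s ''mrow'' = mrow \<and> arr s ''out'' = out"

definition state_inv ::
  "nat set \<Rightarrow> (nat \<Rightarrow> nat) \<Rightarrow> (nat \<Rightarrow> nat) \<Rightarrow> nat \<Rightarrow> nat \<Rightarrow> state \<Rightarrow> nat set \<Rightarrow> bool" where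
  "state_inv K mate mrow j c s P \<longleftrightarrow>
     bfs_inv K mate mrow j c (arr s ''q'') (reg s ''t'') (arr s ''vis'') (arr s ''par'')
       (reg s ''x'') (reg s ''v'') (reg s ''p'') P"

text \<open>An iteration costs at most 36 units, paid by 60 for each entry of the row; the extra 10
  cover the final test. Since earlier queue entries are kept, the outer loop still recognises the
  rows already scanned.\<close>

lemma scan_runs:
  assumes fr: "frame j c k mate mrow out s" and mt: "matching J mate mrow" and K: "J \<subseteq> K" "K \<subseteq> {..<m}"
    and g: "g < m" "reg s ''g'' = g" "reg s ''i'' = off g" "reg s ''e'' = off (Suc g)"
    and gq: "g \<in> arr s ''q'' ` {..<reg s ''t''}" and h: "reg s ''h'' = h"
    and c: "c \<le> W" and inv: "state_inv K mate mrow j c s P"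
    and N: "a + 60 * length (rows ! g) + 10 \<le> B"
  shows "runs W scan s a (\<lambda>s' a'. frame j c k mate mrow out s' \<and> reg s' ''h'' = h \<and>
     (\<forall>b<reg s ''t''. arr s' ''q'' b = arr s ''q'' b) \<and>
     reg s ''t'' \<le> reg s' ''t'' \<and> state_inv K mate mrow j c s' (P \<union> H g) \<and> a' \<le> B)"
proof -
  let ?E = "\<lambda>i. (!) (concat rows) ` {off g..<i}"
  let ?I = "\<lambda>s' a'. frame j c k mate mrow out s' \<and> reg s' ''h'' = h \<and>
     (\<forall>b<reg s ''t''. arr s' ''q'' b = arr s ''q'' b) \<and> reg s ''t'' \<le> reg s' ''t'' \<and>
     reg s' ''g'' = g \<and> reg s' ''e'' = off (Suc g) \<and> off g \<le> reg s' ''i'' \<and> reg s' ''i'' \<le> off (Suc g) \<and>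
     state_inv K mate mrow j c s' (P \<union> ?E (reg s' ''i'')) \<and> 60 * (off (Suc g) - reg s' ''i'') + 10 + a' \<le> B"
  have finK: "finite K" "card K \<le> m" using K(2) finite_subset card_mono[OF _ K(2)] by auto
  show ?thesis
    unfolding scan_def
  proof (rule runs_While[where I = ?I and B = B], goal_cases)
    case 1
    show ?case using fr g h inv N by (simp add: off_Suc)
  next
    case (2 s' a')
    then have I: "?I s' a'" .
    let ?i = "reg s' ''i''" and ?t = "reg s' ''t''"
    let ?u = "concat rows ! ?i"
    have fr': "frame j c k mate mrow out s'" and regs: "reg s' ''h'' = h"
      "\<forall>b<reg s ''t''. arr s' ''q'' b = arr s ''q'' b" "reg s ''t'' \<le> ?t" "reg s' ''g'' = g"
      "reg s' ''e'' = off (Suc g)" "off g \<le> ?i" "?i \<le> off (Suc g)"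
      and time: "60 * (off (Suc g) - ?i) + 10 + a' \<le> B"
      using I by blast+
    have off: "off (Suc g) \<le> W" "off (Suc g) \<le> S" using off_le[of "Suc g"] W by auto
    have bfs: "bfs_inv K mate mrow j c (arr s' ''q'') (reg s' ''t'') (arr s' ''vis'') (arr s' ''par'')
       (reg s' ''x'') (reg s' ''v'') (reg s' ''p'') (P \<union> ?E ?i)" using I unfolding state_inv_def by blast
    have t: "?t \<le> m" using bfs_inv_card[OF bfs finK(1)] finK(2) by simp
    have visc: "arr s' ''vis'' a \<le> W" for a using bfs c unfolding bfs_inv_def by (meson le_trans)
    show ?case
    proof (cases "?i < off (Suc g)")
      case False
      then have "?i = off (Suc g)" using regs by simp
      then show ?thesis using bfs fr' regs time off H_eq[OF g(1)] by (simp add: state_inv_def)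
    next
      case True
      have u: "?u \<in> H g" using True regs unfolding H_eq[OF g(1)] by (intro imageI) simp
      have "{off g..<Suc ?i} = insert ?i {off g..<?i}" using regs by (simp add: atLeastLessThanSuc)
      then have E: "P \<union> ?E (Suc ?i) = insert ?u (P \<union> ?E ?i)" by simp
      have uW: "?u \<le> W" using H_bound[OF g(1) u] W by simp
      have bnd: "?i \<le> W" "Suc ?i \<le> W" "g \<le> W" "1 \<le> W" "Suc ?t \<le> W" "arr s' ''elem'' ?i = ?u"
        "reg s' ''c'' = c" "arr s' ''mate'' = mate"
        using True fr' off W g t by (simp_all add: frame_def)
      have mate: "mate ?u \<le> W" using matching_mate_le[OF mt, of ?u] W by simp
      have w: "mate ?u - Suc 0 \<in> K \<and> mrow (mate ?u - Suc 0) = ?u" if "mate ?u \<noteq> 0"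
        using mt that K(1) unfolding matching_def by auto
      obtain b where "b < reg s ''t''" "g = arr s ''q'' b" using gq by blast
      then have gq': "g \<in> arr s' ''q'' ` {..<?t}" using regs(2,3) by (intro image_eqI[of _ _ b]) auto
      \<comment> \<open>Naming the number \<open>d\<close> of entries after the current one removes
        truncated subtraction from the time bound.\<close>
      obtain d where d: "off (Suc g) = Suc (?i + d)" using True less_imp_Suc_add by blast
      have ti: "60 * d + 70 + a' \<le> B" using time d by simp
      consider (free) "mate ?u = 0" | (old) "mate ?u \<noteq> 0" "arr s' ''vis'' (mate ?u - Suc 0) = c"
        | (new) "mate ?u \<noteq> 0" "arr s' ''vis'' (mate ?u - Suc 0) \<noteq> c" by blast
      then show ?thesis
      proof cases
        case free
        show ?thesis
          using True uW bnd off d c ti free regs fr' bfs_inv_free[OF bfs free u gq', folded E]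
          by (simp add: frame_def state_inv_def)
      next
        case old
        show ?thesis
          using True uW bnd off d c ti old regs mate fr' visc bfs_inv_old[OF bfs old, folded E]
          by (simp add: frame_def state_inv_def)
      next
        case new
        note w = w[OF new(1)]
        show ?thesis
          using True uW bnd off d c ti new regs mate fr' visc w
            bfs_inv_new[OF bfs new(1) refl new(2) conjunct1[OF w] conjunct2[OF w] u gq', folded E]
          by (simp add: frame_def state_inv_def)
      qed
    qed
  qed
qed

text \<open>The time allotted to a visited row: 60 per entry, and 40 to cover the 18 units from the
  loop test to the start of its scan and the constant 10 of the scan.\<close>

abbreviation weight where "weight g \<equiv> 60 * length (rows ! g) + 40"

lemma bfs_inv_queue:
  "bfs_inv K mate mrow j c q t vis par x v p P \<Longrightarrow> inj_on q {..<t} \<and> q ` {..<t} \<subseteq> K"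
  unfolding bfs_inv_def by blast

text \<open>The total weight of the rows of \<open>K\<close> not yet taken from the queue is a
  potential that bounds the remaining time. When the loop ends, \<open>h\<close> equals
  \<open>t\<close>, so every visited row has been scanned.\<close>

lemma search_loop_runs:
  assumes fr: "frame j c k mate mrow out s" and mt: "matching J mate mrow" and K: "J \<subseteq> K" "K \<subseteq> {..<m}"
    and c: "c \<le> W" and inv: "state_inv K mate mrow j c s {}" and h: "reg s ''h'' = 0"
    and time: "(\<Sum>g\<in>K. weight g) + 10 + a \<le> B"
  shows "runs W search_loop s a (\<lambda>s' a'. frame j c k mate mrow out s' \<and>
     state_inv K mate mrow j c s' (\<Union>(H ` arr s' ''q'' ` {..<reg s' ''t''})) \<and> a' \<le> B)"
proof -
  let ?D = "\<lambda>s'. arr s' ''q'' ` {..<reg s' ''h''}"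
  let ?I = "\<lambda>s' a'. frame j c k mate mrow out s' \<and> reg s' ''h'' \<le> reg s' ''t'' \<and>
     state_inv K mate mrow j c s' (\<Union>(H ` ?D s')) \<and> (\<Sum>g\<in>K - ?D s'. weight g) + 10 + a' \<le> B"
  have finK: "finite K" "card K \<le> m" using K(2) finite_subset card_mono[OF _ K(2)] by auto
  show ?thesis
    unfolding search_loop_def
  proof (rule runs_While[where I = ?I and B = B], goal_cases)
    case 1
    show ?case using fr h inv time by simp
  next
    case (2 s' a')
    then have I: "?I s' a'" .
    let ?h = "reg s' ''h''" and ?t = "reg s' ''t''"
    define g where "g = arr s' ''q'' ?h"
    have fr': "frame j c k mate mrow out s'" and ht: "?h \<le> ?t"
      and inv': "state_inv K mate mrow j c s' (\<Union>(H ` ?D s'))"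
      and time': "(\<Sum>g\<in>K - ?D s'. weight g) + 10 + a' \<le> B"
      using I by blast+
    have t: "?t \<le> m" using bfs_inv_card[OF inv'[unfolded state_inv_def] finK(1)] finK(2) by simp
    have mW: "Suc m \<le> W" using W by simp
    show ?case
    proof (cases "?h < ?t")
      case False
      then have "?h = ?t" using ht by simp
      moreover have "10 + a' \<le> B" using time' by linarith
      ultimately show ?thesis using fr' inv' t mW by simp
    next
      case True
      have q: "inj_on (arr s' ''q'') {..<?t}" "arr s' ''q'' ` {..<?t} \<subseteq> K"
        using bfs_inv_queue[OF inv'[unfolded state_inv_def]] by auto
      have g: "g \<in> K" "g < m" "g \<in> arr s' ''q'' ` {..<?t}" using q(2) K(2) True by (auto simp: g_def)
      \<comment> \<open>Injectivity of the queue shows that row \<open>g\<close> is new, so its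
        weight is still part of the potential.\<close>
      have "g \<notin> ?D s'" using inj_on_image_mem_iff[OF q(1), of ?h "{..<?h}"] True by (simp add: g_def)
      have D: "arr s' ''q'' ` {..<Suc ?h} = insert g (?D s')" by (auto simp: g_def lessThan_Suc)
      define r where "r = (\<Sum>g\<in>K - insert g (?D s'). weight g)"
      have eq: "K - ?D s' = insert g (K - insert g (?D s'))" using g(1) \<open>g \<notin> ?D s'\<close> by blast
      have sum: "(\<Sum>g\<in>K - ?D s'. weight g) = weight g + r"
        unfolding r_def eq by (rule sum.insert) (use finK(1) in auto)
      have time'': "weight g + r + 10 + a' \<le> B" using time' unfolding sum by simp
      let ?s = "s'\<lparr>reg := (reg s')(''g'' := g, ''h'' := Suc ?h, ''i'' := off g, ''e'' := off (Suc g))\<rparr>"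
      have run: "runs W scan ?s (a' + 18) (\<lambda>s'' a''. frame j c k mate mrow out s'' \<and> reg s'' ''h'' = Suc ?h \<and>
         (\<forall>b<reg ?s ''t''. arr s'' ''q'' b = arr ?s ''q'' b) \<and>
         reg ?s ''t'' \<le> reg s'' ''t'' \<and> state_inv K mate mrow j c s'' (\<Union>(H ` ?D s') \<union> H g) \<and> a'' \<le> B - (r + 10))"
      proof (rule scan_runs)
        show "frame j c k mate mrow out ?s" using fr' by (simp add: frame_def)
        show "state_inv K mate mrow j c ?s (\<Union>(H ` ?D s'))" using inv' by (simp add: state_inv_def)
        show "a' + 18 + 60 * length (rows ! g) + 10 \<le> B - (r + 10)" using time'' by linarith
      qed (use mt K g c in simp_all)
      have "runs W scan ?s (a' + 18) ?I"
      proof (rule runs_mono[OF run], elim conjE, intro conjI)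
        fix s'' a''
        assume *: "frame j c k mate mrow out s''" "reg s'' ''h'' = Suc ?h"
          "\<forall>b<reg ?s ''t''. arr s'' ''q'' b = arr ?s ''q'' b" "reg ?s ''t'' \<le> reg s'' ''t''"
          "state_inv K mate mrow j c s'' (\<Union>(H ` ?D s') \<union> H g)" "a'' \<le> B - (r + 10)"
        show "frame j c k mate mrow out s''" by fact
        show "reg s'' ''h'' \<le> reg s'' ''t''" using *(2,4) True by simp
        have "?D s'' = arr s' ''q'' ` {..<Suc ?h}" unfolding *(2) using *(3) True by (intro image_cong) auto
        then have D': "?D s'' = insert g (?D s')" by (simp add: D)
        have "\<Union>(H ` ?D s'') = \<Union>(H ` ?D s') \<union> H g" unfolding D' by auto
        then show "state_inv K mate mrow j c s'' (\<Union>(H ` ?D s''))" using *(5) by simp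
        show "(\<Sum>g\<in>K - ?D s''. weight g) + 10 + a'' \<le> B"
          unfolding D' r_def[symmetric] using *(6) time'' by linarith
      qed
      moreover have "arr s' ''off'' g = off g" "arr s' ''off'' (Suc g) = off (Suc g)"
        using fr' g(2) by (auto simp: frame_def)
      moreover have "off g \<le> W" "off (Suc g) \<le> W" using off_le[of g] off_le[of "Suc g"] W by auto
      moreover have "g \<le> W" "Suc g \<le> W" "Suc ?h \<le> W" "?t \<le> W" "?h \<le> W" "1 \<le> W" using g(2) W t mW True by auto
      moreover have "a' \<le> B" using time'' by linarith
      ultimately show ?thesis using True by (simp add: g_def[symmetric] eval_nat_numeral)
    qed
  qed
qed

text \<open>Marks of earlier searches are at most \<open>c\<close>; under the stamp
  \<open>Suc c\<close> they count as unvisited, and only \<open>j\<close> starts out marked.\<close>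

lemma search_runs:
  assumes fr: "frame j c k mate mrow out s" and mt: "matching J mate mrow" and K: "J \<subseteq> K" "K \<subseteq> {..<m}"
    and c: "Suc c \<le> W" and j: "j \<in> K" and vis: "\<forall>g. arr s ''vis'' g \<le> c"
    and time: "(\<Sum>g\<in>K. weight g) + 40 + a \<le> B"
  shows "runs W search s a (\<lambda>s' a'. frame j (Suc c) k mate mrow out s' \<and>
     state_inv K mate mrow j (Suc c) s' (\<Union>(H ` arr s' ''q'' ` {..<reg s' ''t''})) \<and> a' \<le> B)"
proof -
  let ?s = "s\<lparr>arr := (arr s)(''vis'' := (arr s ''vis'')(j := Suc c), ''q'' := (arr s ''q'')(0 := j)),
    reg := (reg s)(''c'' := Suc c, ''h'' := 0, ''t'' := Suc 0, ''x'' := 0)\<rparr>"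
  have "runs W search_loop ?s (a + 16) (\<lambda>s' a'. frame j (Suc c) k mate mrow out s' \<and>
     state_inv K mate mrow j (Suc c) s' (\<Union>(H ` arr s' ''q'' ` {..<reg s' ''t''})) \<and> a' \<le> B)"
  proof (rule search_loop_runs)
    show "frame j (Suc c) k mate mrow out ?s" using fr by (simp add: frame_def)
    show "state_inv K mate mrow j (Suc c) ?s {}"
      unfolding state_inv_def using bfs_inv_start[OF j, of "arr s ''vis''" "Suc c"] vis by (simp add: less_Suc_eq_le)
  qed (use mt K c time in simp_all)
  moreover have "j \<le> W" "1 \<le> W" using j K(2) W by auto
  moreover have "reg s ''c'' = c" "reg s ''j'' = j" using fr by (simp_all add: frame_def)
  ultimately show ?thesis using c by (simp add: search_def fun_upd_twist eval_nat_numeral)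
qed

subsection \<open>Augmentation\<close>

text \<open>A matching in which \<open>v\<close> is free, but \<open>mate v\<close> may be stale.\<close>

definition loose_matching :: "nat set \<Rightarrow> nat \<Rightarrow> (nat \<Rightarrow> nat) \<Rightarrow> (nat \<Rightarrow> nat) \<Rightarrow> bool" where
  "loose_matching J v mate mrow \<longleftrightarrow> J \<subseteq> {..<m} \<and>
     (\<forall>g\<in>J. mrow g \<in> H g \<and> mrow g \<noteq> v \<and> mate (mrow g) = Suc g) \<and>
     (\<forall>u. u \<noteq> v \<longrightarrow> mate u \<noteq> 0 \<longrightarrow> mate u - 1 \<in> J \<and> mrow (mate u - 1) = u)"

lemma matching_loose: "matching J mate mrow \<Longrightarrow> mate v = 0 \<Longrightarrow> loose_matching J v mate mrow"
  unfolding matching_def loose_matching_def by (metis nat.distinct(1))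

text \<open>Row \<open>p\<close> gives up \<open>mrow p\<close>, which becomes the exempt element:
  its entry in \<open>mate\<close> still names \<open>p\<close>.\<close>

lemma loose_matching_step:
  assumes l: "loose_matching J v mate mrow" and p: "p \<in> J" "v \<in> H p"
  shows "loose_matching J (mrow p) (mate(v := Suc p)) (mrow(p := v))"
proof -
  have J: "J \<subseteq> {..<m}" and g: "\<And>g. g \<in> J \<Longrightarrow> mrow g \<in> H g \<and> mrow g \<noteq> v \<and> mate (mrow g) = Suc g"
    and u: "\<And>u. u \<noteq> v \<Longrightarrow> mate u \<noteq> 0 \<Longrightarrow> mate u - 1 \<in> J \<and> mrow (mate u - 1) = u"
    using l by (auto simp: loose_matching_def)
  have "mrow a \<noteq> mrow p" if "a \<in> J" "a \<noteq> p" for a using g[OF that(1)] g[OF p(1)] that(2) by auto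
  moreover have "v \<noteq> mrow p" using g[OF p(1)] by simp
  moreover have "mate w - 1 \<noteq> p" if "w \<noteq> mrow p" "w \<noteq> v" "mate w \<noteq> 0" for w
    using u[OF that(2,3)] that(1) by metis
  ultimately show ?thesis
    unfolding loose_matching_def using J g u p by simp
qed

lemma loose_matching_finish:
  assumes l: "loose_matching J v mate mrow" and j: "j < m" "v \<in> H j" "j \<notin> J"
  shows "matching (insert j J) (mate(v := Suc j)) (mrow(j := v))"
proof -
  have J: "J \<subseteq> {..<m}" and g: "\<And>g. g \<in> J \<Longrightarrow> mrow g \<in> H g \<and> mrow g \<noteq> v \<and> mate (mrow g) = Suc g"
    and u: "\<And>u. u \<noteq> v \<Longrightarrow> mate u \<noteq> 0 \<Longrightarrow> mate u - 1 \<in> J \<and> mrow (mate u - 1) = u"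
    using l by (auto simp: loose_matching_def)
  have "mate w - 1 \<noteq> j" if "w \<noteq> v" "mate w \<noteq> 0" for w using u[OF that] j(3) by metis
  then show ?thesis
    unfolding matching_def using J g u j by auto
qed

lemma matching_unmatch:
  assumes mt: "matching (insert j J) mate mrow" and j: "j \<notin> J"
  shows "matching J (mate(mrow j := 0)) mrow"
proof -
  have J: "insert j J \<subseteq> {..<m}" and g: "\<And>g. g \<in> insert j J \<Longrightarrow> mrow g \<in> H g \<and> mate (mrow g) = Suc g"
    and u: "\<And>u. mate u \<noteq> 0 \<Longrightarrow> mate u - 1 \<in> insert j J \<and> mrow (mate u - 1) = u"
    using mt by (auto simp: matching_def)
  have "mrow a \<noteq> mrow j" if "a \<in> J" for a using g that j by (metis insertCI nat.inject)
  moreover have "mate w - 1 \<in> J" if "w \<noteq> mrow j" "mate w \<noteq> 0" for w using u[OF that(2)] that(1) by (metis insertE)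
  ultimately show ?thesis
    unfolding matching_def using J g u by simp
qed

text \<open>Parents stand at smaller queue positions, so the walk reaches \<open>j\<close>, at
  position 0, in fewer than \<open>t\<close> steps of 25 units each. Rows not yet reached keep their
  partners, so the edges recorded by the search remain usable.\<close>

lemma augment_loop_runs:
  assumes fr: "frame j c k mate mrow out s" and mt: "matching J mate mrow" and j: "j < m" "j \<notin> J"
    and inv: "state_inv (insert j J) mate mrow j c s P" and x: "reg s ''x'' \<noteq> 0"
    and time: "30 * reg s ''t'' + 10 + a \<le> B"
  shows "runs W augment_loop s a (\<lambda>s' a'. \<exists>mate' mrow'. frame j c k mate' mrow' out s' \<and>
     loose_matching J (reg s' ''v'') mate' mrow' \<and> reg s' ''v'' \<in> H j \<and> arr s' ''vis'' = arr s ''vis'' \<and> a' \<le> B)"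
proof -
  let ?q = "arr s ''q''" and ?t = "reg s ''t''" and ?par = "arr s ''par''"
  have bfs: "bfs_inv (insert j J) mate mrow j c ?q ?t (arr s ''vis'') ?par (reg s ''x'') (reg s ''v'') (reg s ''p'') P"
    using inv by (simp add: state_inv_def)
  have q0: "?q 0 = j" and q: "inj_on ?q {..<?t}" "?q ` {..<?t} \<subseteq> insert j J"
    and par: "\<forall>b<?t. 0 < b \<longrightarrow> (\<exists>b'<b. ?par (?q b) = ?q b' \<and> mrow (?q b) \<in> H (?q b'))"
    and fin: "mate (reg s ''v'') = 0" "reg s ''v'' \<in> H (reg s ''p'')" "reg s ''p'' \<in> ?q ` {..<?t}"
    using bfs x unfolding bfs_inv_def by - (elim conjE, simp)+
  have J: "J \<subseteq> {..<m}" using mt by (simp add: matching_def)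
  let ?J = "\<lambda>s' a' b mate' mrow'. frame j c k mate' mrow' out s' \<and> loose_matching J (reg s' ''v'') mate' mrow' \<and>
     reg s' ''v'' \<in> H (reg s' ''p'') \<and> b < ?t \<and> reg s' ''p'' = ?q b \<and> (\<forall>d\<le>b. mrow' (?q d) = mrow (?q d)) \<and>
     arr s' ''par'' = ?par \<and> arr s' ''vis'' = arr s ''vis'' \<and> 30 * b + 10 + a' \<le> B"
  define Inv where "Inv = (\<lambda>s' a'. \<exists>b mate' mrow'. ?J s' a' b mate' mrow')"
  show ?thesis
    unfolding augment_loop_def
  proof (rule runs_While[where I = Inv and B = B], goal_cases)
    case 1
    obtain b where b: "b < ?t" "reg s ''p'' = ?q b" using fin(3) by auto
    then have "?J s a b mate mrow"
      using fr matching_loose[OF mt fin(1)] fin(2) time by auto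
    then show ?case unfolding Inv_def by blast
  next
    case (2 s' a')
    then obtain b mate' mrow' where I: "?J s' a' b mate' mrow'" unfolding Inv_def by blast
    let ?p = "reg s' ''p''" and ?v = "reg s' ''v''"
    have fr': "frame j c k mate' mrow' out s'" and l: "loose_matching J ?v mate' mrow'" and v: "?v \<in> H ?p"
      and b: "b < ?t" "?p = ?q b" and same: "\<forall>d\<le>b. mrow' (?q d) = mrow (?q d)"
      and arrs: "arr s' ''par'' = ?par" "arr s' ''vis'' = arr s ''vis''" and time': "30 * b + 10 + a' \<le> B"
      using I by blast+
    have p: "?p \<in> insert j J" using b q(2) by auto
    then have pm: "?p < m" using J j by auto
    have bnd: "?p \<le> W" "Suc ?p \<le> W" "j \<le> W" "1 \<le> W" "?v \<le> W" "?p - j + (j - ?p) \<le> W"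
      using pm j(1) W H_bound[OF pm v] by auto
    have regs: "reg s' ''j'' = j" "arr s' ''mrow'' = mrow'" "arr s' ''mate'' = mate'" using fr' by (simp_all add: frame_def)
    show ?case
    proof (cases "?p = j")
      case True
      have "\<exists>mate' mrow'. frame j c k mate' mrow' out s' \<and> loose_matching J ?v mate' mrow'" using fr' l by blast
      then show ?thesis using True v arrs time' bnd regs by simp
    next
      case False
      then have pJ: "?p \<in> J" using p by simp
      have "0 < b" using False q0 b by (cases b) auto
      then obtain b' where b': "b' < b" "?par ?p = ?q b'" "mrow ?p \<in> H (?q b')" using par b by metis
      have mp: "mrow' ?p = mrow ?p" using same b(2) by simp
      have "mrow ?p < n" using l pJ H_bound[OF pm] mp unfolding loose_matching_def by metis
      then have bnd2: "mrow ?p \<le> W" using W by simp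
      have "?q b' \<in> ?q ` {..<?t}" using b'(1) b(1) by simp
      then have "?q b' \<in> insert j J" using q(2) by blast
      then have bnd3: "?q b' \<le> W" using J j W by auto
      let ?s = "s'\<lparr>reg := (reg s')(''w'' := mrow ?p), arr := (arr s')(''mate'' := mate'(?v := Suc ?p), ''mrow'' := mrow'(?p := ?v)),
        reg := (reg s')(''w'' := mrow ?p, ''v'' := mrow ?p, ''p'' := ?q b')\<rparr>"
      have "?J ?s (a' + 25) b' (mate'(?v := Suc ?p)) (mrow'(?p := ?v))"
      proof (intro conjI)
        show "frame j c k (mate'(?v := Suc ?p)) (mrow'(?p := ?v)) out ?s" using fr' by (simp add: frame_def)
        show "loose_matching J (reg ?s ''v'') (mate'(?v := Suc ?p)) (mrow'(?p := ?v))"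
          using loose_matching_step[OF l pJ v] mp by simp
        \<comment> \<open>All positions up to \<open>b'\<close> precede \<open>b\<close>, so by
          injectivity their rows differ from the one just rematched.\<close>
        have "?q d \<noteq> ?p" if "d \<le> b'" for d
          using inj_onD[OF q(1), of d b] that b b' by auto
        then show "\<forall>d\<le>b'. (mrow'(?p := ?v)) (?q d) = mrow (?q d)" using same b'(1) by simp
        show "30 * b' + 10 + (a' + 25) \<le> B" using time' b'(1) by linarith
      qed (use b b' arrs in simp_all)
      then have "Inv ?s (a' + 25)" unfolding Inv_def by blast
      moreover have "a' \<le> B" using time' by simp
      moreover have "0 < ?p - j + (j - ?p)" using False by linarith
      ultimately show ?thesis
        using bnd bnd2 bnd3 regs arrs b'(2) mp by (simp add: eval_nat_numeral)
    qed
  qed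
qed

lemma augment_runs:
  assumes fr: "frame j c k mate mrow out s" and mt: "matching J mate mrow" and j: "j < m" "j \<notin> J"
    and inv: "state_inv (insert j J) mate mrow j c s P" and x: "reg s ''x'' \<noteq> 0"
    and time: "30 * reg s ''t'' + 40 + a \<le> B"
  shows "runs W augment s a (\<lambda>s' a'. \<exists>mate' mrow'. frame j c k mate' mrow' out s' \<and>
     matching (insert j J) mate' mrow' \<and> arr s' ''vis'' = arr s ''vis'' \<and> a' \<le> B)"
proof -
  have run: "runs W augment_loop s a (\<lambda>s' a'. \<exists>mate' mrow'. frame j c k mate' mrow' out s' \<and>
     loose_matching J (reg s' ''v'') mate' mrow' \<and> reg s' ''v'' \<in> H j \<and> arr s' ''vis'' = arr s ''vis'' \<and> a' \<le> B - 30)"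
    by (rule augment_loop_runs[OF fr mt j inv x]) (use time in linarith)
  show ?thesis
    unfolding augment_def runs_Seq
  proof (rule runs_mono[OF run], elim exE conjE)
    fix s' a' mate' mrow'
    assume *: "frame j c k mate' mrow' out s'" "loose_matching J (reg s' ''v'') mate' mrow'" "reg s' ''v'' \<in> H j"
      "arr s' ''vis'' = arr s ''vis''" "a' \<le> B - 30"
    let ?v = "reg s' ''v''"
    let ?s = "s'\<lparr>arr := (arr s')(''mate'' := mate'(?v := Suc j), ''mrow'' := mrow'(j := ?v))\<rparr>"
    have "frame j c k (mate'(?v := Suc j)) (mrow'(j := ?v)) out ?s" using *(1) by (simp add: frame_def)
    moreover have "matching (insert j J) (mate'(?v := Suc j)) (mrow'(j := ?v))"
      using loose_matching_finish[OF *(2) j(1) *(3) j(2)] .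
    moreover have "arr ?s ''vis'' = arr s ''vis''" using *(4) by simp
    moreover have "a' + 8 \<le> B" using *(5) time by linarith
    ultimately have "\<exists>mate' mrow'. frame j c k mate' mrow' out ?s \<and> matching (insert j J) mate' mrow' \<and>
      arr ?s ''vis'' = arr s ''vis'' \<and> a' + 8 \<le> B" by blast
    moreover have "?v \<le> W" "Suc j \<le> W" "j \<le> W" "1 \<le> W" using H_bound[OF j(1) *(3)] j(1) W by auto
    moreover have "reg s' ''j'' = j" "arr s' ''mrow'' = mrow'" "arr s' ''mate'' = mate'"
      using *(1) by (simp_all add: frame_def)
    ultimately show "runs W (Store ''mate'' (Var ''v'') (Add (Var ''j'') (Num 1))) s' a'
        (\<lambda>s' a'. runs W (Store ''mrow'' (Var ''j'') (Var ''v'')) s' a'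
          (\<lambda>s' a'. \<exists>mate' mrow'. frame j c k mate' mrow' out s' \<and>
             matching (insert j J) mate' mrow' \<and> arr s' ''vis'' = arr s ''vis'' \<and> a' \<le> B))"
      by (simp add: eval_nat_numeral)
  qed
qed

subsection \<open>The greedy loop\<close>

text \<open>Rejections are recorded with respect to the current \<open>J\<close>, although decided
  for a smaller one: the witness \<open>X\<close> stays a subset as \<open>J\<close> grows.\<close>

definition accepted :: "nat set \<Rightarrow> nat \<Rightarrow> bool" where
  "accepted J j \<longleftrightarrow> J \<subseteq> {..<j} \<and> hall H J \<and>
     (\<forall>f<j. f \<notin> J \<longrightarrow> (\<exists>X\<subseteq>J. card (\<Union>(H ` insert f X)) \<le> card (insert f X)))"

lemma accepted_reject:
  assumes "accepted J j" "\<exists>X\<subseteq>J. card (\<Union>(H ` insert j X)) \<le> card (insert j X)"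
  shows "accepted J (Suc j)"
  using assms unfolding accepted_def less_Suc_eq lessThan_Suc by blast

lemma accepted_accept:
  assumes "accepted J j" "hall H (insert j J)"
  shows "accepted (insert j J) (Suc j)"
  using assms unfolding accepted_def less_Suc_eq lessThan_Suc
  by (meson insertCI insert_mono subset_insertI2)

text \<open>With no free element met, every element of the visited rows is the partner of a visited
  row, so these rows, \<open>j\<close> among them, have too few elements. The set \<open>K\<close>
  is arbitrary because the lemma serves both searches: \<open>j\<close> is unmatched in the first
  and matched in the second.\<close>

lemma search_reject:
  assumes inv: "state_inv (insert j J) mate mrow j c s (\<Union>(H ` arr s ''q'' ` {..<reg s ''t''}))"
    and x: "reg s ''x'' = 0" and mt: "matching K mate mrow" and fin: "finite J"
  shows "\<exists>X\<subseteq>J. card (\<Union>(H ` insert j X)) \<le> card (insert j X)"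
proof -
  let ?R = "arr s ''q'' ` {..<reg s ''t''}"
  have t: "0 < reg s ''t''" "arr s ''q'' 0 = j" and R: "?R \<subseteq> insert j J"
    and free: "\<forall>u\<in>\<Union>(H ` ?R). mate u \<noteq> 0" and closed: "\<forall>u\<in>\<Union>(H ` ?R). mate u \<noteq> 0 \<longrightarrow> mate u - 1 \<in> ?R"
    using inv x unfolding state_inv_def bfs_inv_def by - (elim conjE, simp)+
  have "j \<in> ?R" using t by (metis imageI lessThan_iff)
  then have eq: "insert j (?R - {j}) = ?R" by (rule insert_Diff)
  have "u \<in> mrow ` ?R" if "u \<in> \<Union>(H ` ?R)" for u
    using mt free closed that unfolding matching_def by (metis image_eqI)
  then have "card (\<Union>(H ` ?R)) \<le> card (mrow ` ?R)" by (intro card_mono) auto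
  also have "\<dots> \<le> card ?R" by (rule card_image_le) simp
  finally show ?thesis using R eq by (intro exI[of _ "?R - {j}"]) auto
qed

text \<open>A violating \<open>X\<close> contains \<open>j\<close>, and as all its rows are matched,
  \<open>mrow\<close> maps it onto its union. Then every visited row, reached from \<open>j\<close>
  through partners, lies in \<open>X\<close>, and the free element that was met would be
  matched.\<close>

lemma search_accept:
  assumes hall: "hall H J" and mt: "matching (insert j J) mate mrow" and fin: "finite J"
    and inv: "state_inv (insert j J) mate mrow j c s P" and x: "reg s ''x'' \<noteq> 0"
  shows "hall H (insert j J)"
  unfolding hall_def
proof (intro allI impI, rule ccontr)
  fix X assume X: "X \<subseteq> insert j J" "X \<noteq> {}" and "\<not> card X < card (\<Union>(H ` X))"
  then have le: "card (\<Union>(H ` X)) \<le> card X" by simp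
  have jX: "j \<in> X"
  proof (rule ccontr)
    assume "j \<notin> X"
    then show False using hallD[OF hall, of X] X le by fastforce
  qed
  have finX: "finite X" using X fin finite_subset by blast
  have g: "\<And>g. g \<in> X \<Longrightarrow> mrow g \<in> H g \<and> mate (mrow g) = Suc g" using mt X unfolding matching_def by blast
  have finH: "finite (\<Union>(H ` X))" using finX by (simp add: H_def)
  have "inj_on mrow X" using g by (metis inj_onI nat.inject)
  then have "card (mrow ` X) = card X" by (rule card_image)
  moreover have "mrow ` X \<subseteq> \<Union>(H ` X)" using g by blast
  ultimately have N: "mrow ` X = \<Union>(H ` X)" using le finH by (metis card_seteq)
  let ?q = "arr s ''q''"
  have q0: "?q 0 = j" and R: "?q ` {..<reg s ''t''} \<subseteq> insert j J"
    and par: "\<forall>b<reg s ''t''. 0 < b \<longrightarrow> (\<exists>b'<b. arr s ''par'' (?q b) = ?q b' \<and> mrow (?q b) \<in> H (?q b'))"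
    and fr: "mate (reg s ''v'') = 0" "reg s ''v'' \<in> H (reg s ''p'')" "reg s ''p'' \<in> ?q ` {..<reg s ''t''}"
    using inv x unfolding state_inv_def bfs_inv_def by - (elim conjE, simp)+
  have "b < reg s ''t'' \<Longrightarrow> ?q b \<in> X" for b
  proof (induction b rule: less_induct)
    case (less b)
    show ?case
    proof (cases "b = 0")
      case True
      then show ?thesis using q0 jX by simp
    next
      case False
      then obtain b' where b': "b' < b" "mrow (?q b) \<in> H (?q b')" using par less.prems by blast
      then have "?q b' \<in> X" using less by simp
      then obtain a where a: "a \<in> X" "mrow (?q b) = mrow a" using N b' by blast
      have "?q b \<in> insert j J" using R less.prems by blast
      then have "mate (mrow (?q b)) = Suc (?q b)" using mt unfolding matching_def by blast
      moreover have "mate (mrow (?q b)) = Suc a" unfolding a(2) using g[OF a(1)] by blast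
      ultimately show ?thesis using a(1) by simp
    qed
  qed
  then have "?q ` {..<reg s ''t''} \<subseteq> X" by (simp add: image_subset_iff)
  then have "reg s ''p'' \<in> X" using fr(3) by (rule subsetD)
  then have "reg s ''v'' \<in> mrow ` X" unfolding N using fr(2) by (rule UN_I)
  then obtain a where a: "a \<in> X" "reg s ''v'' = mrow a" by (auto elim: imageE)
  then show False using g[OF a(1)] fr(1) by simp
qed

lemma weight_sum:
  assumes mt: "matching J mate mrow" and j: "j < m"
  shows "(\<Sum>g\<in>insert j J. weight g) \<le> 100 * S + 40" "card (insert j J) \<le> S + 1"
proof -
  have J: "insert j J \<subseteq> {..<m}" using mt j by (auto simp: matching_def)
  show card: "card (insert j J) \<le> S + 1"
    using matching_card[OF mt] card_insert_le_m1[of "S + 1" J j] by simp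
  have "(\<Sum>g\<in>insert j J. weight g) = 60 * (\<Sum>g\<in>insert j J. length (rows ! g)) + 40 * card (insert j J)"
    by (simp only: sum.distrib sum_distrib_left sum_constant) simp
  \<comment> \<open>The entries cost at most \<open>60 * S\<close> and the at most
    \<open>S + 1\<close> rows 40 each; the extra row is \<open>j\<close>, which may be
    empty.\<close>
  then show "(\<Sum>g\<in>insert j J. weight g) \<le> 100 * S + 40" using sum_length[OF J] card by linarith
qed

text \<open>Every row starts at most two searches, hence the bound \<open>2 * j\<close> on the
  stamp, which keeps it within a word.\<close>

definition round_inv :: "nat \<Rightarrow> state \<Rightarrow> bool" where
  "round_inv j s \<longleftrightarrow> (\<exists>c k mate mrow out. frame j c k mate mrow out s \<and> (\<forall>g. arr s ''vis'' g \<le> c) \<and>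
     c \<le> 2 * j \<and> inj_on out {..<k} \<and> matching (out ` {..<k}) mate mrow \<and> accepted (out ` {..<k}) j)"

text \<open>The invariant is claimed for the state after the pending increment of \<open>j\<close>,
  which \<open>process_row\<close> performs after either branch.\<close>

lemma decide_runs:
  assumes fr: "frame j c k mate mrow out s" and j: "j < m" and c: "c \<le> 2 * Suc j"
    and inj: "inj_on out {..<k}" and J: "J = out ` {..<k}" and acc: "accepted J j"
    and mt: "matching (insert j J) mate mrow"
    and inv: "state_inv (insert j J) mate mrow j c s (\<Union>(H ` arr s ''q'' ` {..<reg s ''t''}))"
    and time: "a + 20 \<le> B"
  shows "runs W decide s a (\<lambda>s' a'. round_inv (Suc j) (s'\<lparr>reg := (reg s')(''j'' := Suc j)\<rparr>) \<and>
    reg s' ''j'' = j \<and> a' \<le> B)"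
proof -
  have jJ: "j \<notin> J" and Jj: "J \<subseteq> {..<j}" and hall: "hall H J" using acc by (auto simp: accepted_def)
  have finJ: "finite J" using J by simp
  have "k \<le> m" using Jj j inj card_mono[of "{..<j}" J] by (simp add: J card_image)
  have mrow: "mrow j \<in> H j" "mrow j < n" using mt H_bound[OF j] by (auto simp: matching_def)
  have regs: "reg s ''j'' = j" "reg s ''k'' = k" "arr s ''mate'' = mate" "arr s ''mrow'' = mrow" "arr s ''out'' = out"
    using fr by (simp_all add: frame_def)
  have vis: "\<forall>g. arr s ''vis'' g \<le> c" and x: "reg s ''x'' \<le> 1"
    using inv unfolding state_inv_def bfs_inv_def by - (elim conjE, assumption)+
  have bnd: "j \<le> W" "k \<le> W" "Suc k \<le> W" "1 \<le> W" "mrow j \<le> W" "reg s ''x'' \<le> W" using j \<open>k \<le> m\<close> mrow(2) W x by auto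
  show ?thesis
  proof (cases "reg s ''x'' = 0")
    case True
    let ?s = "s\<lparr>arr := (arr s)(''mate'' := mate(mrow j := 0)), reg := (reg s)(''j'' := Suc j)\<rparr>"
    have "accepted J (Suc j)" using accepted_reject[OF acc search_reject[OF inv True mt finJ]] .
    moreover have "frame (Suc j) c k (mate(mrow j := 0)) mrow out ?s" using fr by (simp add: frame_def)
    ultimately have "round_inv (Suc j) ?s"
      unfolding round_inv_def using vis c inj matching_unmatch[OF mt jJ] J by (intro exI conjI) auto
    then show ?thesis using True regs bnd time by (simp add: decide_def)
  next
    case False
    let ?s = "s\<lparr>arr := (arr s)(''out'' := out(k := j)), reg := (reg s)(''k'' := Suc k, ''j'' := Suc j)\<rparr>"
    have J': "(out(k := j)) ` {..<Suc k} = insert j J" by (auto simp: J lessThan_Suc image_iff)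
    have "accepted (insert j J) (Suc j)" using accepted_accept[OF acc search_accept[OF hall mt finJ inv False]] .
    moreover have "inj_on (out(k := j)) {..<Suc k}" using inj jJ by (auto simp: J lessThan_Suc inj_on_def)
    moreover have "frame (Suc j) c (Suc k) mate mrow (out(k := j)) ?s" using fr by (simp add: frame_def)
    moreover have "\<forall>g. arr ?s ''vis'' g \<le> c" using vis by simp
    ultimately have "round_inv (Suc j) ?s"
      unfolding round_inv_def using c mt J' by metis
    then show ?thesis using False regs bnd time by (simp add: decide_def)
  qed
qed

text \<open>Two searches and an augmentation end by time \<open>a + 230 * S + 240\<close>; as
  \<open>1 \<le> S\<close>, a multiple of \<open>S\<close> absorbs the constants.\<close>

lemma process_row_runs:
  assumes inv: "round_inv j s" and j: "j < m" and S: "1 \<le> S" and time: "a + 990 * S \<le> B"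
  shows "runs W process_row s a (\<lambda>s' a'. round_inv (Suc j) s' \<and> a' \<le> B)"
proof -
  obtain c k mate mrow out where fr: "frame j c k mate mrow out s" and vis: "\<forall>g. arr s ''vis'' g \<le> c"
    and c: "c \<le> 2 * j" and inj: "inj_on out {..<k}" and mt: "matching (out ` {..<k}) mate mrow"
    and acc: "accepted (out ` {..<k}) j"
    using inv unfolding round_inv_def by blast
  define J where "J = out ` {..<k}"
  note mt = mt[folded J_def] and acc = acc[folded J_def]
  have jJ: "j \<notin> J" using acc by (auto simp: accepted_def)
  have K: "J \<subseteq> insert j J" "insert j J \<subseteq> {..<m}" "j \<in> insert j J" using mt j by (auto simp: matching_def)
  have cW: "Suc c \<le> W" "Suc (Suc c) \<le> W" and jW: "Suc j \<le> W" "1 \<le> W" using c j W by auto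
  note ws = weight_sum[OF mt j]
  let ?P = "\<lambda>s'. \<Union>(H ` arr s' ''q'' ` {..<reg s' ''t''})"
  have run1: "runs W search s a (\<lambda>s1 a1. frame j (Suc c) k mate mrow out s1 \<and>
     state_inv (insert j J) mate mrow j (Suc c) s1 (?P s1) \<and> a1 \<le> a + 100 * S + 80)"
    by (rule search_runs[OF fr mt K(1,2) cW(1) K(3) vis]) (use ws in linarith)
  show ?thesis
    unfolding process_row_def runs_Seq
  proof (rule runs_mono[OF run1], elim conjE)
    fix s1 a1
    assume fr1: "frame j (Suc c) k mate mrow out s1" and inv1: "state_inv (insert j J) mate mrow j (Suc c) s1 (?P s1)"
      and t1: "a1 \<le> a + 100 * S + 80"
    have x1: "reg s1 ''x'' \<le> 1" and vis1: "\<forall>g. arr s1 ''vis'' g \<le> Suc c"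
      using inv1 unfolding state_inv_def bfs_inv_def by - (elim conjE, assumption)+
    have xW: "reg s1 ''x'' \<le> W" using x1 jW by linarith
    let ?Q = "\<lambda>s' a'. runs W (Assign ''j'' (Add (Var ''j'') (Num 1))) s' a' (\<lambda>s' a'. round_inv (Suc j) s' \<and> a' \<le> B)"
    have step: "?Q s' a'" if "round_inv (Suc j) (s'\<lparr>reg := (reg s')(''j'' := Suc j)\<rparr>)" "reg s' ''j'' = j" "a' + 4 \<le> B" for s' a'
      using that jW by simp
    show "runs W (If (Equal (Var ''x'') (Num 0)) Skip (augment ;; search ;; decide)) s1 a1 ?Q"
    proof (cases "reg s1 ''x'' = 0")
      case True
      let ?s = "s1\<lparr>reg := (reg s1)(''j'' := Suc j)\<rparr>"
      have "accepted J (Suc j)" using accepted_reject[OF acc search_reject[OF inv1 True mt]] J_def by simp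
      moreover have "frame (Suc j) (Suc c) k mate mrow out ?s" using fr1 by (simp add: frame_def)
      moreover have "\<forall>g. arr ?s ''vis'' g \<le> Suc c" using vis1 by simp
      moreover have "Suc c \<le> 2 * Suc j" using c by simp
      ultimately have "round_inv (Suc j) ?s"
        unfolding round_inv_def using inj mt J_def by blast
      moreover have "reg s1 ''j'' = j" using fr1 by (simp add: frame_def)
      moreover have "a1 + 4 + 4 \<le> B" using t1 time S by linarith
      ultimately have "?Q s1 (a1 + 4)" by (intro step) simp_all
      then show ?thesis using True jW by (simp add: eval_nat_numeral del: runs_Assign)
    next
      case False
      have "reg s1 ''t'' \<le> S + 1" using bfs_inv_card[OF inv1[unfolded state_inv_def]] ws(2) J_def by simp
      then have time1: "30 * reg s1 ''t'' + 40 + (a1 + 3) \<le> a + 130 * S + 160" using t1 by linarith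
      have "runs W (augment ;; search ;; decide) s1 (a1 + 3) ?Q"
        unfolding runs_Seq
      proof (rule runs_mono[OF augment_runs[OF fr1 mt j jJ inv1 False time1]], elim exE conjE)
        fix s2 a2 mate' mrow'
        assume fr2: "frame j (Suc c) k mate' mrow' out s2" and mt2: "matching (insert j J) mate' mrow'"
          and vis2: "arr s2 ''vis'' = arr s1 ''vis''" and t2: "a2 \<le> a + 130 * S + 160"
        have time2: "(\<Sum>g\<in>insert j J. weight g) + 40 + a2 \<le> a + 230 * S + 240" using ws t2 by linarith
        have vis2': "\<forall>g. arr s2 ''vis'' g \<le> Suc c" using vis1 vis2 by simp
        show "runs W search s2 a2 (\<lambda>s' a'. runs W decide s' a' ?Q)"
        proof (rule runs_mono[OF search_runs[OF fr2 mt2 order_refl K(2) cW(2) K(3) vis2' time2]], elim conjE)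
          fix s3 a3
          assume fr3: "frame j (Suc (Suc c)) k mate' mrow' out s3"
            and inv3: "state_inv (insert j J) mate' mrow' j (Suc (Suc c)) s3 (?P s3)" and t3: "a3 \<le> a + 230 * S + 240"
          have c3: "Suc (Suc c) \<le> 2 * Suc j" using c by simp
          have time3: "a3 + 20 \<le> B - 4" using t3 time S by linarith
          show "runs W decide s3 a3 ?Q"
            by (rule runs_mono[OF decide_runs[OF fr3 j c3 inj J_def acc mt2 inv3 time3]])
              (elim conjE, rule step; use time S in linarith)
        qed
      qed
      then show ?thesis using False jW xW by (simp add: eval_nat_numeral del: runs_Assign runs_Seq)
    qed
  qed
qed

lemma greedy_runs:
  "runs W greedy (input_state n rows) 0 (\<lambda>s a. inj_on (arr s ''out'') {..<reg s ''k''} \<and>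
     accepted (arr s ''out'' ` {..<reg s ''k''}) m \<and> a \<le> 1000 * (m * S + 1))"
proof -
  let ?s = "input_state n rows" and ?B = "1000 * (m * S + 1)"
  have frame: "frame 0 0 0 (\<lambda>_. 0) (\<lambda>_. 0) (\<lambda>_. 0) ?s"
    by (simp add: frame_def input_state_def off_def)
  have off_m: "off m = S" by (simp add: off_def)
  have offs: "arr ?s ''off'' m = S" "reg ?s ''m'' = m" using frame off_m by (simp_all add: frame_def)
  have bnd: "m \<le> W" "S \<le> W" using W by auto
  show ?thesis
  proof (cases "S = 0")
    case True
    have "H f = {}" if "f < m" for f using True that by (auto simp: H_def)
    \<comment> \<open>With all sets empty, the empty subfamily witnesses every rejection: one set
      and no element.\<close>
    then have "accepted {} m" by (auto simp: accepted_def hall_def)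
    moreover have "reg ?s ''k'' = 0" using frame by (simp add: frame_def)
    ultimately show ?thesis using True offs bnd by (simp add: greedy_def)
  next
    case False
    then have S: "1 \<le> S" by linarith
    have init: "round_inv 0 ?s"
      unfolding round_inv_def using frame
      by (intro exI conjI) (assumption, auto simp: input_state_def matching_def accepted_def hall_def)
    define Inv where "Inv = (\<lambda>s a. \<exists>j\<le>m. round_inv j s \<and> (m - j) * (1000 * S) + 10 + a \<le> ?B)"
    \<comment> \<open>The four units spent so far are the cost of the guard.\<close>
    have "runs W (While (Less (Var ''j'') (Var ''m'')) process_row) ?s (Suc (Suc (Suc (Suc 0)))) (\<lambda>s a. inj_on (arr s ''out'') {..<reg s ''k''} \<and>
      accepted (arr s ''out'' ` {..<reg s ''k''}) m \<and> a \<le> ?B)"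
    proof (rule runs_While[where I = Inv and B = ?B], goal_cases)
      case 1
      show ?case unfolding Inv_def using init by (intro exI[of _ 0]) simp
    next
      case (2 s a)
      then obtain j where j: "j \<le> m" "round_inv j s" "(m - j) * (1000 * S) + 10 + a \<le> ?B" unfolding Inv_def by blast
      have regs: "reg s ''j'' = j" "reg s ''m'' = m" using j(2) by (auto simp: round_inv_def frame_def)
      have aB: "a + 3 \<le> ?B" using j(3) by linarith
      show ?case
      proof (cases "j < m")
        case True
        then have "m - j = Suc (m - Suc j)" by simp
        then have t: "(m - Suc j) * (1000 * S) + 10 + a + 1000 * S \<le> ?B" using j(3) by simp
        have "runs W process_row s (a + 3) (\<lambda>s' a'. round_inv (Suc j) s' \<and>
          a' \<le> ?B - ((m - Suc j) * (1000 * S) + 10))"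
          by (rule process_row_runs[OF j(2) True S]) (use t S in linarith)
        then have "runs W process_row s (a + 3) Inv"
          by (rule runs_mono) (use True t in \<open>auto simp: Inv_def intro!: exI[of _ "Suc j"]\<close>)
        then show ?thesis using True regs bnd aB by (simp add: numeral_3_eq_3)
      next
        case False
        then have "j = m" using j(1) by simp
        then obtain k out where "inj_on out {..<k}" "accepted (out ` {..<k}) m" "reg s ''k'' = k" "arr s ''out'' = out"
          using j(2) by (auto simp: round_inv_def frame_def)
        then show ?thesis using \<open>j = m\<close> regs bnd aB by simp
      qed
    qed
    then show ?thesis using False offs bnd by (auto simp: greedy_def)
  qed
qed

end

section \<open>From numbers to sets\<close>

text \<open>Injective numberings \<open>f\<close> of the elements and \<open>g\<close> of the sets
  preserve the sizes of subfamilies and of their unions, which is all that \<open>hall\<close>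
  depends on.\<close>

lemma hall_image_transfer:
  assumes us: "inj_on f V" and ms: "inj_on g J" and H: "\<And>j. j \<in> J \<Longrightarrow> H j \<subseteq> V"
    and eq: "\<And>j. j \<in> J \<Longrightarrow> Us (g j) = f ` H j"
  shows "X \<subseteq> J \<Longrightarrow> card (\<Union>(Us ` g ` X)) = card (\<Union>(H ` X))"
    and "hall H J \<Longrightarrow> hall Us (g ` J)"
proof -
  show U: "card (\<Union>(Us ` g ` X)) = card (\<Union>(H ` X))" if X: "X \<subseteq> J" for X
  proof -
    have "\<Union>(Us ` g ` X) = f ` \<Union>(H ` X)" using X eq by (auto simp: subset_iff)
    moreover have "\<Union>(H ` X) \<subseteq> V" using X H by blast
    ultimately show ?thesis using us by (metis card_image inj_on_subset)
  qed
  show "hall Us (g ` J)" if hall: "hall H J"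
    unfolding hall_def
  proof (intro allI impI)
    fix Y assume Y: "Y \<subseteq> g ` J" "Y \<noteq> {}"
    then obtain X where X: "X \<subseteq> J" "Y = g ` X" by (auto simp: subset_image_iff)
    have "card Y = card X" unfolding X(2) using ms X(1) by (metis card_image inj_on_subset)
    also have "\<dots> < card (\<Union>(H ` X))" using hallD[OF hall X(1)] X(2) Y(2) by simp
    finally show "card Y < card (\<Union>(Us ` Y))" unfolding X(2) U[OF X(1)] .
  qed
qed

theorem theorem14:
  "\<exists>(p :: com) (C :: nat). \<forall>(U :: 'a set) (M :: 'b set) (Us :: 'b \<Rightarrow> 'a set) us ms rows.
     finite U \<and> finite M \<and> (\<forall>f\<in>M. Us f \<subseteq> U) \<and> listing U M Us us ms rows \<longrightarrow>
     (\<exists>t s F.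
        exec (C * (card U + card M + (\<Sum>f\<in>M. card (Us f)) + 1)) p
          (input_state (card U) rows) t s \<and>
        t \<le> C * (card M * (\<Sum>f\<in>M. card (Us f)) + 1) \<and>
        output_represents ms s F \<and>
        maximum_frs_subset U M Us F)"
\<comment> \<open>One constant serves both bounds; it comes from the running time, while the word
  size only needs a factor of 4.\<close>
proof (rule exI[of _ greedy], rule exI[of _ 1000], intro allI impI, elim conjE)
  fix U :: "'a set" and M :: "'b set" and Us :: "'b \<Rightarrow> 'a set" and us ms rows
  assume finU: "finite U" and finM: "finite M" and UsU: "\<forall>f\<in>M. Us f \<subseteq> U"
    and listing: "listing U M Us us ms rows"
  let ?m = "length rows" and ?S = "length (concat rows)"
  let ?W = "1000 * (card U + card M + (\<Sum>f\<in>M. card (Us f)) + 1)"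
  have us: "distinct us" "set us = U" and ms: "distinct ms" "set ms = M" "?m = length ms"
    and rows: "\<And>j. j < ?m \<Longrightarrow> distinct (rows ! j) \<and> set (rows ! j) \<subseteq> {..<length us} \<and>
        Us (ms ! j) = (!) us ` set (rows ! j)"
    using listing by (auto simp: listing_def)
  have n: "card U = length us" using us by (auto simp: distinct_card)
  have m: "card M = ?m" using ms by (auto simp: distinct_card)
  have inj_us: "inj_on ((!) us) {..<length us}" and inj_ms: "inj_on ((!) ms) {..<?m}"
    using us(1) ms(1,3) by (auto simp: inj_on_nth)
  have M_eq: "M = (!) ms ` {..<?m}" using ms(2,3) by (auto simp: set_conv_nth)
  have "card (Us (ms ! j)) = length (rows ! j)" if "j < ?m" for j
    using rows[OF that] inj_us by (metis card_image distinct_card inj_on_subset)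
  then have S: "(\<Sum>f\<in>M. card (Us f)) = ?S"
    unfolding M_eq using inj_ms by (simp add: sum.reindex length_concat sum_list_sum_nth atLeast0LessThan)
  interpret rows_input rows "card U" ?W
  proof
    fix r u assume "r \<in> set rows" "u \<in> set r"
    then show "u < card U" using rows n by (metis in_set_conv_nth lessThan_iff subsetD)
  qed (simp add: m S)
  obtain t s where t: "exec ?W greedy (input_state (card U) rows) t s" "t \<le> 1000 * (?m * ?S + 1)"
    and inj: "inj_on (arr s ''out'') {..<reg s ''k''}" and acc: "accepted (arr s ''out'' ` {..<reg s ''k''}) ?m"
    using greedy_runs unfolding runs_def by auto
  define J where "J = arr s ''out'' ` {..<reg s ''k''}"
  define F where "F = (!) ms ` J"
  have J: "J \<subseteq> {..<?m}" and hall: "hall H J"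
    and rej: "\<And>f. f < ?m \<Longrightarrow> f \<notin> J \<Longrightarrow> \<exists>X\<subseteq>J. card (\<Union>(H ` insert f X)) \<le> card (insert f X)"
    using acc by (auto simp: accepted_def J_def)
  have eq: "\<And>j. j \<in> {..<?m} \<Longrightarrow> Us (ms ! j) = (!) us ` H j" and Hus: "\<And>j. j \<in> {..<?m} \<Longrightarrow> H j \<subseteq> {..<length us}"
    using rows by (auto simp: H_def)
  note transfer = hall_image_transfer[OF inj_us, where Us = Us and H = H and g = "(!) ms"]
  have FM: "F \<subseteq> M" unfolding F_def M_eq using J by blast
  have frs_hall: "has_frs U F' Us \<longleftrightarrow> hall Us F'" if "F' \<subseteq> M" for F'
    by (rule has_frs_iff_hall) (use that finU finM UsU finite_subset in auto)
  have hallF: "hall Us F"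
    unfolding F_def
  proof (rule transfer(2)[OF _ _ _ hall])
    show "inj_on ((!) ms) J" using inj_ms J by (rule inj_on_subset)
  qed (use J eq Hus in blast)+
  have "card F' \<le> card F" if F': "F' \<subseteq> M" "has_frs U F' Us" for F'
  proof (rule hall_greedy_maximum[OF finM _ FM hallF _ F'(1)])
    show "finite (Us f)" if "f \<in> M" for f using that UsU finU finite_subset by blast
    show "hall Us F'" using F' frs_hall by simp
    show "\<exists>Y\<subseteq>F. card (\<Union>(Us ` insert f Y)) \<le> card (insert f Y)" if f: "f \<in> M - F" for f
    proof -
      obtain j where j: "j < ?m" "f = ms ! j" using f M_eq by auto
      then have "j \<notin> J" using f by (auto simp: F_def)
      then obtain X where X: "X \<subseteq> J" "card (\<Union>(H ` insert j X)) \<le> card (insert j X)" using rej j by blast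
      have jX: "insert j X \<subseteq> {..<?m}" using X J j by auto
      have img: "insert f ((!) ms ` X) = (!) ms ` insert j X" using j by simp
      have "card (\<Union>(Us ` (!) ms ` insert j X)) = card (\<Union>(H ` insert j X))"
        by (rule transfer(1)[OF inj_ms Hus eq jX])
      moreover have "card ((!) ms ` insert j X) = card (insert j X)"
        using inj_ms jX by (metis card_image inj_on_subset)
      ultimately show ?thesis
        using X unfolding F_def by (intro exI[of _ "(!) ms ` X"]) (simp only: img, blast)
    qed
  qed
  then have "maximum_frs_subset U M Us F" using FM hallF frs_hall by (auto simp: maximum_frs_subset_def)
  moreover have "output_represents ms s F"
    using inj J ms(3) by (auto simp: output_represents_def F_def J_def image_image)
  ultimately show "\<exists>t s F. exec ?W greedy (input_state (card U) rows) t s \<and>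
      t \<le> 1000 * (card M * (\<Sum>f\<in>M. card (Us f)) + 1) \<and>
      output_represents ms s F \<and> maximum_frs_subset U M Us F"
    using t unfolding m S by blast
qed

end
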